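(* Let $\Omega\subset\mathbb{R}^n$ be open and assume that $F:\Omega\to\mathbb{R}^m$ is semismooth on $\Omega$ with respect to a mapping $\Psi:\mathbb{R}^n\rightrightarrows\mathbb{R}^{m\times n}$. Then the following statements hold: (i) $F$ is locally Lipschitz on $\Omega$. (ii) For every $x\in\Omega$ there holds $\emptyset\neq\mathrm{conv}\,\overline{\nabla}F(x)\subset(\mathrm{cocl}\,\Psi)(x)$. (iii) Let $\Omega_\Psi$ denote the set of all $x\in\Omega$ such that $(\mathrm{cocl}\,\Psi)(x)$ is a singleton. Then $\Omega\setminus\Omega_\Psi$ has Lebesgue measure zero. Moreover, $F$ is strictly differentiable at every $x\in\Omega_\Psi$ with $\mathrm{conv}\,\overline{\nabla}F(x)=\{\nabla F(x)\}=(\mathrm{cocl}\,\Psi)(x)=\Psi(x)$.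
   Context: A multifunction $\Psi:\mathbb{R}^n\rightrightarrows\mathbb{R}^{m\times n}$ assigns to each $x$ a (possibly empty) set of $m\times n$ matrices; $\mathrm{dom}\,\Psi=\{x : \Psi(x)\neq\emptyset\}$, $\mathrm{gph}\,\Psi=\{(x,A) : A\in\Psi(x)\}$. $\Psi$ is locally bounded at $\bar x$ if there are a neighborhood $U$ of $\bar x$ and $M\ge 0$ with $\|A\|\le M$ for all $A\in\Psi(x)$, $x\in U$ (operator norm). Let $F:\Omega\to\mathbb{R}^m$ with $\Omega\subset\mathbb{R}^n$ open. $F$ is semismooth with respect to $\Psi$ at $\bar x\in\Omega$ if $\mathrm{dom}\,\Psi$ is a neighborhood of $\bar x$, $\Psi$ is locally bounded at $\bar x$, and $$\lim_{x\to\bar x,\ x\in\Omega,\ x\ne\bar x}\frac{\sup\{\|F(x)-F(\bar x)-A(x-\bar x)\| : A\in\Psi(x)\}}{\|x-\bar x\|}=0.$$ $F$ is semismooth on $\Omega$ with respect to $\Psi$ if this holds at every $\bar x\in\Omega$. No continuity of $F$ is assumed a priori. $\mathrm{cl}\,\Psi$ is the multifunction whose graph is the closure of $\mathrm{gph}\,\Psi$, and $(\mathrm{cocl}\,\Psi)(x):=\mathrm{conv}\big((\mathrm{cl}\,\Psi)(x)\big)$, where $\mathrm{conv}$ is the convex hull. $\mathcal{O}_F$ is the set of points of $\Omega$ where $F$ is Fréchet differentiable, $\nabla F(x)\in\mathbb{R}^{m\times n}$ is the Jacobian. The B-Jacobian is $\overline{\nabla}F(\bar x)=\{A : A=\lim_k\nabla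 F(x_k)\text{ for some sequence }x_k\to\bar x,\ x_k\in\mathcal{O}_F\}$. $F$ is strictly differentiable at $\bar x\in\Omega$ if $F$ is Lipschitz near $\bar x$ and there is an $m\times n$ matrix $A$ such that $\lim_{x\to\bar x,\,t\downarrow0}\frac{F(x+tu)-F(x)}{t}=Au$ for all $u\in\mathbb{R}^n$. *)

theory Defs
  imports "HOL-Analysis.Analysis"
begin

(* A multifunction is a set-valued total function; an m x n matrix is real^'n^'m.
   A map F on an open set Omega is a total function together with the set Omega:
   its values outside Omega play no role in any of the notions below as long as
   Omega is open and the point under consideration lies in Omega. *)

definition mdom :: "('a \<Rightarrow> 'b set) \<Rightarrow> 'a set" where
  "mdom \<Psi> = {x. \<Psi> x \<noteq> {}}"

definition gph :: "('a \<Rightarrow> 'b set) \<Rightarrow> ('a \<times> 'b) set" where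
  "gph \<Psi> = {(x, A). A \<in> \<Psi> x}"

definition cl_mf :: "('a::topological_space \<Rightarrow> 'b::topological_space set) \<Rightarrow> 'a \<Rightarrow> 'b set" where
  "cl_mf \<Psi> x = {A. (x, A) \<in> closure (gph \<Psi>)}"

definition cocl :: "('a::topological_space \<Rightarrow> 'b::real_normed_vector set) \<Rightarrow> 'a \<Rightarrow> 'b set" where
  "cocl \<Psi> x = convex hull (cl_mf \<Psi> x)"

definition opnorm :: "real^'n^'m \<Rightarrow> real" where
  "opnorm A = onorm ((*v) A)"

definition locally_bounded_at :: "(real^'n \<Rightarrow> (real^'n^'m) set) \<Rightarrow> real^'n \<Rightarrow> bool" where
  "locally_bounded_at \<Psi> x \<longleftrightarrow>
     (\<exists>U M. open U \<and> x \<in> U \<and> 0 \<le> M \<and> (\<forall>y\<in>U. \<forall>A\<in>\<Psi> y. opnorm A \<le> M))"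

(* The supremum is the real one. The first two conjuncts make the set nonempty and
   bounded above for all x near x0, so its default values never affect the limit. *)
definition semismooth_at ::
  "(real^'n \<Rightarrow> real^'m) \<Rightarrow> (real^'n) set \<Rightarrow> (real^'n \<Rightarrow> (real^'n^'m) set) \<Rightarrow> real^'n \<Rightarrow> bool" where
  "semismooth_at F \<Omega> \<Psi> x0 \<longleftrightarrow>
     x0 \<in> interior (mdom \<Psi>) \<and>
     locally_bounded_at \<Psi> x0 \<and>
     ((\<lambda>x. (SUP A\<in>\<Psi> x. norm (F x - F x0 - A *v (x - x0))) / norm (x - x0)) \<longlongrightarrow> 0)
       (at x0 within \<Omega>)"

definition semismooth_on ::
  "(real^'n \<Rightarrow> real^'m) \<Rightarrow> (real^'n) set \<Rightarrow> (real^'n \<Rightarrow> (real^'n^'m) set) \<Rightarrow> bool" where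
  "semismooth_on F \<Omega> \<Psi> \<longleftrightarrow> (\<forall>x\<in>\<Omega>. semismooth_at F \<Omega> \<Psi> x)"

definition lipschitz_near ::
  "('a::metric_space \<Rightarrow> 'b::metric_space) \<Rightarrow> 'a set \<Rightarrow> 'a \<Rightarrow> bool" where
  "lipschitz_near F \<Omega> x \<longleftrightarrow> (\<exists>U L. open U \<and> x \<in> U \<and> L-lipschitz_on (U \<inter> \<Omega>) F)"

definition locally_lipschitz_on ::
  "('a::metric_space \<Rightarrow> 'b::metric_space) \<Rightarrow> 'a set \<Rightarrow> bool" where
  "locally_lipschitz_on F \<Omega> \<longleftrightarrow> (\<forall>x\<in>\<Omega>. lipschitz_near F \<Omega> x)"

definition diff_points :: "(real^'n \<Rightarrow> real^'m) \<Rightarrow> (real^'n) set \<Rightarrow> (real^'n) set" where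
  "diff_points F \<Omega> = {x \<in> \<Omega>. F differentiable (at x)}"

definition B_jacobian ::
  "(real^'n \<Rightarrow> real^'m) \<Rightarrow> (real^'n) set \<Rightarrow> real^'n \<Rightarrow> (real^'n^'m) set" where
  "B_jacobian F \<Omega> x0 =
     {A. \<exists>X. (\<forall>k. X k \<in> diff_points F \<Omega>) \<and> X \<longlonglongrightarrow> x0 \<and>
             (\<lambda>k. jacobian F (at (X k))) \<longlonglongrightarrow> A}"

(* The limit is joint in (x, t), and x = x0 is allowed. *)
definition strictly_differentiable_at ::
  "(real^'n \<Rightarrow> real^'m) \<Rightarrow> (real^'n) set \<Rightarrow> real^'n \<Rightarrow> bool" where
  "strictly_differentiable_at F \<Omega> x0 \<longleftrightarrow>
     lipschitz_near F \<Omega> x0 \<and>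
     (\<exists>A :: real^'n^'m. \<forall>u.
        ((\<lambda>(x, t). (F (x + t *\<^sub>R u) - F x) /\<^sub>R t) \<longlongrightarrow> A *v u) (nhds x0 \<times>\<^sub>F at_right 0))"

definition singleton_points :: "(real^'n) set \<Rightarrow> (real^'n \<Rightarrow> (real^'n^'m) set) \<Rightarrow> (real^'n) set" where
  "singleton_points \<Omega> \<Psi> = {x \<in> \<Omega>. is_singleton (cocl \<Psi> x)}"

end

theory Submission
  imports Defs
begin

text \<open>
  Local boundedness of \<open>\<Psi>\<close> and semismoothness bound the pointwise Lipschitz constant of \<open>F\<close>
  near each point, so \<open>F\<close> is locally Lipschitz; the same argument applied to \<open>F - A\<close> near a
  point where \<open>cl \<Psi>\<close> takes the single value \<open>A\<close> gives strict differentiability there.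

  Semismoothness passes to \<open>cl \<Psi>\<close> and forces \<open>norm ((A - B) *v u) \<rightarrow> 0\<close> for
  \<open>A, B \<in> cl \<Psi> (x + t u)\<close> as \<open>0 \<noteq> t \<rightarrow> 0\<close>. So the points of a line of direction \<open>u\<close> at which
  \<open>norm ((A - B) *v u) \<ge> \<epsilon>\<close> is possible are isolated, and Fubini shows that \<open>cl \<Psi>\<close> is
  single-valued almost everywhere. This replaces Rademacher's theorem.

  If a limit of Jacobians were outside \<open>cocl \<Psi> x\<close>, a hyperplane would separate it, so that
  \<open>C \<bullet> \<nabla>F \<ge> b\<close> almost everywhere near \<open>x\<close> but \<open>C \<bullet> \<nabla>F(z) < b\<close> at some point \<open>z\<close> of
  differentiability. As \<open>C \<bullet> \<nabla>F\<close> is the divergence of the field \<open>transpose C *v F\<close>, this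
  contradicts the fact that the divergence at \<open>z\<close> is the limit of its averages over small
  neighbourhoods of \<open>z\<close>.
\<close>

section \<open>Lipschitz bounds from pointwise bounds on increments\<close>

text \<open>A compactness argument on the segment from x to y replaces the mean value theorem, so no
  differentiability of f enters. The slack e is removed at the end by letting it tend to 0.\<close>

lemma lipschitz_on_convex_pointwise:
  fixes f :: "'a::real_normed_vector \<Rightarrow> 'b::real_normed_vector"
  assumes "convex S" "0 \<le> M"
    and local: "\<And>x e. x \<in> S \<Longrightarrow> e > 0 \<Longrightarrow>
      \<forall>\<^sub>F y in at x within S. norm (f y - f x) \<le> (M + e) * norm (y - x)"
  shows "M-lipschitz_on S f"
proof (rule lipschitz_onI)
  fix x y assume "x \<in> S" "y \<in> S"
  have *: "norm (f y - f x) \<le> (M + e) * norm (y - x)" if "e > 0" for e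
  proof -
    define p where "p t = x + t *\<^sub>R (y - x)" for t :: real
    have p_in: "p t \<in> S" if "0 \<le> t" "t \<le> 1" for t
      using convexD_alt[OF \<open>convex S\<close> \<open>x \<in> S\<close> \<open>y \<in> S\<close> that]
      by (simp add: p_def algebra_simps)
    have p_diff: "norm (p t - p s) = \<bar>t - s\<bar> * norm (y - x)" for s t
    proof -
      have "p t - p s = (t - s) *\<^sub>R (y - x)" by (simp add: p_def algebra_simps)
      then show ?thesis by simp
    qed
    \<comment> \<open>\<open>Bolzano\<close> propagates to [0,1] any property of intervals that is
      additive over adjacent intervals and holds for all short intervals around each point. It
      quantifies over all real a and b, so the guards \<open>0 \<le> a\<close> and
      \<open>b \<le> 1\<close> keep the end points on the segment.\<close>
    have "0 \<le> (0::real) \<longrightarrow> (1::real) \<le> 1 \<longrightarrow>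
      norm (f (p 1) - f (p 0)) \<le> (M + e) * ((1 - 0) * norm (y - x))"
    proof (rule Bolzano[where P = "\<lambda>a b. 0 \<le> a \<longrightarrow> b \<le> 1 \<longrightarrow>
        norm (f (p b) - f (p a)) \<le> (M + e) * ((b - a) * norm (y - x))"])
      fix a b c :: real
      assume 1: "0 \<le> a \<longrightarrow> b \<le> 1 \<longrightarrow> norm (f (p b) - f (p a)) \<le> (M + e) * ((b - a) * norm (y - x))"
        and 2: "0 \<le> b \<longrightarrow> c \<le> 1 \<longrightarrow> norm (f (p c) - f (p b)) \<le> (M + e) * ((c - b) * norm (y - x))"
        and "a \<le> b" "b \<le> c"
      show "0 \<le> a \<longrightarrow> c \<le> 1 \<longrightarrow> norm (f (p c) - f (p a)) \<le> (M + e) * ((c - a) * norm (y - x))"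
      proof (intro impI)
        assume "0 \<le> a" "c \<le> 1"
        have "norm (f (p c) - f (p a)) \<le> norm (f (p c) - f (p b)) + norm (f (p b) - f (p a))"
          by (rule norm_diff_triangle_ineq[of "f (p c)" "f (p b)" "f (p b)" "f (p a)", simplified])
        also have "\<dots> \<le> (M + e) * ((c - b) * norm (y - x)) + (M + e) * ((b - a) * norm (y - x))"
          using 1 2 \<open>a \<le> b\<close> \<open>b \<le> c\<close> \<open>0 \<le> a\<close> \<open>c \<le> 1\<close> by (intro add_mono) auto
        also have "\<dots> = (M + e) * ((c - a) * norm (y - x))"
          by (simp add: algebra_simps)
        finally show "norm (f (p c) - f (p a)) \<le> (M + e) * ((c - a) * norm (y - x))" .
      qed
    next
      fix t :: real assume t: "0 \<le> t" "t \<le> 1"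
      from local[OF p_in[OF t] \<open>e > 0\<close>] obtain d where d: "d > 0"
        "\<And>z. z \<in> S \<Longrightarrow> z \<noteq> p t \<Longrightarrow> dist z (p t) < d \<Longrightarrow> norm (f z - f (p t)) \<le> (M + e) * norm (z - p t)"
        unfolding eventually_at by blast
      have near: "norm (f (p s) - f (p t)) \<le> (M + e) * (\<bar>s - t\<bar> * norm (y - x))"
        if "0 \<le> s" "s \<le> 1" "\<bar>s - t\<bar> < d / (norm (y - x) + 1)" for s
      proof (cases "p s = p t")
        case True
        then show ?thesis using \<open>e > 0\<close> \<open>0 \<le> M\<close> by simp
      next
        case False
        have "\<bar>s - t\<bar> * norm (y - x) \<le> \<bar>s - t\<bar> * (norm (y - x) + 1)"
          by (intro mult_left_mono) auto
        also have "\<dots> < d"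
          using that(3) by (simp add: pos_less_divide_eq add_nonneg_pos)
        finally have "dist (p s) (p t) < d" by (simp add: dist_norm p_diff)
        from d(2)[OF p_in[OF that(1,2)] False this] show ?thesis by (simp add: p_diff)
      qed
      show "\<exists>d>0. \<forall>a b. a \<le> t \<and> t \<le> b \<and> b - a < d \<longrightarrow> 0 \<le> a \<longrightarrow> b \<le> 1 \<longrightarrow>
        norm (f (p b) - f (p a)) \<le> (M + e) * ((b - a) * norm (y - x))"
      proof (intro exI[of _ "d / (norm (y - x) + 1)"] conjI allI impI; (elim conjE)?)
        show "d / (norm (y - x) + 1) > 0" using \<open>d > 0\<close> by (simp add: add_nonneg_pos)
        fix a b assume ab: "a \<le> t" "t \<le> b" "b - a < d / (norm (y - x) + 1)" "0 \<le> a" "b \<le> 1"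
        \<comment> \<open>The hypothesis controls only increments starting at the fixed point
          \<open>p t\<close>. As t lies between a and b, splitting there loses nothing: the two
          distances add up to b - a.\<close>
        have "norm (f (p b) - f (p a)) \<le> norm (f (p b) - f (p t)) + norm (f (p a) - f (p t))"
          using norm_triangle_ineq4[of "f (p b) - f (p t)" "f (p a) - f (p t)"] by simp
        also have "\<dots> \<le> (M + e) * (\<bar>b - t\<bar> * norm (y - x)) + (M + e) * (\<bar>a - t\<bar> * norm (y - x))"
          using ab t by (intro add_mono near) auto
        also have "\<dots> = (M + e) * ((b - a) * norm (y - x))"
          using ab by (simp add: algebra_simps)
        finally show "norm (f (p b) - f (p a)) \<le> (M + e) * ((b - a) * norm (y - x))" .
      qed
    qed simp
    then show ?thesis by (simp add: p_def)
  qed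
  have "((\<lambda>e. (M + e) * norm (y - x)) \<longlongrightarrow> (M + 0) * norm (y - x)) (at_right 0)"
    by (intro tendsto_intros)
  moreover have "\<forall>\<^sub>F e in at_right 0. norm (f y - f x) \<le> (M + e) * norm (y - x)"
    using eventually_at_right_less by (rule eventually_mono) (rule *)
  ultimately have "norm (f y - f x) \<le> (M + 0) * norm (y - x)"
    by (rule tendsto_lowerbound) simp
  then show "dist (f x) (f y) \<le> M * dist x y"
    by (simp add: dist_norm norm_minus_commute)
qed fact

section \<open>Semismoothness in terms of single matrices, and local Lipschitz continuity\<close>

lemma norm_matrix_vector_mult_le: "norm (A *v x) \<le> norm A * norm x"
  for A :: "real^'n^'m"
proof -
  have "norm (A *v x) \<le> L2_set (\<lambda>i. norm (A $ i) * norm x) UNIV"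
    unfolding norm_vec_def[of "A *v x"]
    by (intro L2_set_mono) (auto simp: matrix_mult_dot Cauchy_Schwarz_ineq2)
  also have "\<dots> = norm A * norm x"
    by (simp add: norm_vec_def[of A] L2_set_left_distrib)
  finally show ?thesis .
qed

text \<open>The norm of the matrix type is the Euclidean norm of the entries, while local
  boundedness is stated with the operator norm. Each entry is at most the operator norm, and this
  crude comparison is enough to transfer boundedness.\<close>

lemma norm_le_opnorm: "norm A \<le> CARD('m) * CARD('n) * opnorm A" for A :: "real^'n^'m"
proof -
  have "norm A \<le> (\<Sum>i\<in>UNIV. norm (A $ i))"
    unfolding norm_vec_def[of A] by (intro L2_set_le_sum) auto
  also have "\<dots> \<le> (\<Sum>i\<in>(UNIV::'m set). \<Sum>j\<in>(UNIV::'n set). opnorm A)"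
    unfolding opnorm_def
    by (intro sum_mono order_trans[OF norm_le_l1_cart] matrix_component_le_onorm)
  finally show ?thesis by (simp add: mult.assoc)
qed

lemma locally_bounded_at_norm:
  fixes \<Psi> :: "real^'n \<Rightarrow> (real^'n^'m) set"
  assumes "locally_bounded_at \<Psi> x"
  obtains r M where "r > 0" "M \<ge> 0"
    "\<And>y A. y \<in> ball x r \<Longrightarrow> A \<in> \<Psi> y \<Longrightarrow> norm A \<le> M"
proof -
  obtain U M where U: "open U" "x \<in> U" "0 \<le> M" "\<And>y A. y \<in> U \<Longrightarrow> A \<in> \<Psi> y \<Longrightarrow> opnorm A \<le> M"
    using assms unfolding locally_bounded_at_def by blast
  obtain r where r: "r > 0" "ball x r \<subseteq> U" using U(1,2) openE by blast
  show ?thesis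
  proof
    fix y A assume "y \<in> ball x r" "A \<in> \<Psi> y"
    then have "opnorm A \<le> M" using U(4) r by blast
    then show "norm A \<le> CARD('m) * CARD('n) * M"
      by (intro order_trans[OF norm_le_opnorm] mult_left_mono) auto
  qed (use U r in auto)
qed

text \<open>Near x0 local boundedness makes the supremum in the definition a genuine upper bound, so
  the limit controls every single matrix of \<open>\<Psi> x\<close>. If \<open>\<Psi> x\<close> is
  empty, the claim is vacuous there.\<close>

lemma semismooth_at_eventually:
  fixes \<Psi> :: "real^'n \<Rightarrow> (real^'n^'m) set"
  assumes "semismooth_at F \<Omega> \<Psi> x0" "e > 0"
  shows "\<forall>\<^sub>F x in at x0 within \<Omega>. \<forall>A\<in>\<Psi> x. norm (F x - F x0 - A *v (x - x0)) \<le> e * norm (x - x0)"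
proof -
  obtain r M where r: "r > 0" "M \<ge> 0"
    "\<And>y A. y \<in> ball x0 r \<Longrightarrow> A \<in> \<Psi> y \<Longrightarrow> norm A \<le> M"
    by (rule locally_bounded_at_norm[of \<Psi> x0]) (use assms(1) in \<open>auto simp: semismooth_at_def\<close>)
  have "((\<lambda>x. (SUP A\<in>\<Psi> x. norm (F x - F x0 - A *v (x - x0))) / norm (x - x0)) \<longlongrightarrow> 0) (at x0 within \<Omega>)"
    using assms(1) by (simp add: semismooth_at_def)
  then have "\<forall>\<^sub>F x in at x0 within \<Omega>.
    (SUP A\<in>\<Psi> x. norm (F x - F x0 - A *v (x - x0))) / norm (x - x0) < e"
    using \<open>e > 0\<close> by (rule order_tendstoD)
  moreover have "\<forall>\<^sub>F x in at x0 within \<Omega>. x \<in> ball x0 r \<and> x \<noteq> x0"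
    using r(1) by (auto simp: eventually_at dist_commute)
  ultimately show ?thesis
  proof eventually_elim
    case (elim x)
    show ?case
    proof
      fix A assume "A \<in> \<Psi> x"
      have "bdd_above ((\<lambda>A. norm (F x - F x0 - A *v (x - x0))) ` \<Psi> x)"
      proof (rule bdd_aboveI2)
        fix B assume "B \<in> \<Psi> x"
        then have "norm (B *v (x - x0)) \<le> M * norm (x - x0)"
          using r(3) elim by (intro order_trans[OF norm_matrix_vector_mult_le] mult_right_mono) auto
        then show "norm (F x - F x0 - B *v (x - x0)) \<le> norm (F x - F x0) + M * norm (x - x0)"
          using norm_triangle_ineq4[of "F x - F x0" "B *v (x - x0)"] by linarith
      qed
      from cSUP_upper[OF \<open>A \<in> \<Psi> x\<close> this] elim
      show "norm (F x - F x0 - A *v (x - x0)) \<le> e * norm (x - x0)"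
        by (auto simp: divide_simps split: if_splits)
    qed
  qed
qed

text \<open>Take A from \<open>\<Psi> y\<close> at the moving point y. The error of A is small
  compared with y - x by semismoothness at x, and A - A0 contributes at most L times the distance;
  hence the pointwise Lipschitz constant at x is at most L. With A0 = 0 this yields local Lipschitz
  continuity, with A0 the only value of \<open>cl_mf \<Psi>\<close> at a point it yields strict
  differentiability.\<close>

lemma semismooth_on_lipschitz:
  fixes \<Psi> :: "real^'n \<Rightarrow> (real^'n^'m) set"
  assumes "semismooth_on F \<Omega> \<Psi>" "convex S" "S \<subseteq> \<Omega>" "0 \<le> L"
    and bound: "\<And>y A. y \<in> S \<Longrightarrow> A \<in> \<Psi> y \<Longrightarrow> norm (A - A0) \<le> L"
  shows "L-lipschitz_on S (\<lambda>y. F y - A0 *v y)"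
proof (rule lipschitz_on_convex_pointwise)
  fix x and e :: real assume "x \<in> S" "e > 0"
  then have ss: "semismooth_at F \<Omega> \<Psi> x"
    using assms(1,3) by (auto simp: semismooth_on_def)
  have "\<forall>\<^sub>F y in at x within S. \<forall>A\<in>\<Psi> y. norm (F y - F x - A *v (y - x)) \<le> e * norm (y - x)"
    using semismooth_at_eventually[OF ss \<open>e > 0\<close>] \<open>S \<subseteq> \<Omega>\<close>
    by (meson at_le filter_leD)
  moreover have "\<forall>\<^sub>F y in at x within S. \<Psi> y \<noteq> {}"
  proof -
    have "open (interior (mdom \<Psi>))" "x \<in> interior (mdom \<Psi>)"
      using ss by (auto simp: semismooth_at_def)
    then have "\<forall>\<^sub>F y in at x within S. y \<in> interior (mdom \<Psi>)"
      by (rule topological_tendstoD[OF tendsto_ident_at])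
    then show ?thesis
      by (rule eventually_mono) (use interior_subset in \<open>auto simp: mdom_def\<close>)
  qed
  moreover have "\<forall>\<^sub>F y in at x within S. y \<in> S"
    by (auto simp: eventually_at_filter)
  ultimately show "\<forall>\<^sub>F y in at x within S. norm (F y - A0 *v y - (F x - A0 *v x)) \<le> (L + e) * norm (y - x)"
  proof eventually_elim
    case (elim y)
    then obtain A where A: "A \<in> \<Psi> y" by blast
    have "F y - A0 *v y - (F x - A0 *v x) = (F y - F x - A *v (y - x)) + (A - A0) *v (y - x)"
      by (simp add: algebra_simps)
    also have "norm \<dots> \<le> e * norm (y - x) + L * norm (y - x)"
      using elim A bound[OF elim(3) A]
      by (intro norm_triangle_mono order_trans[OF norm_matrix_vector_mult_le] mult_right_mono) auto
    finally show ?case by (simp add: algebra_simps)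
  qed
qed (use assms in auto)

lemma semismooth_on_lipschitz_near:
  fixes \<Psi> :: "real^'n \<Rightarrow> (real^'n^'m) set"
  assumes "open \<Omega>" "semismooth_on F \<Omega> \<Psi>" "x \<in> \<Omega>"
  obtains r L where "r > 0" "ball x r \<subseteq> \<Omega>" "L-lipschitz_on (ball x r) F"
proof -
  obtain r M where r: "r > 0" "M \<ge> 0"
    "\<And>y A. y \<in> ball x r \<Longrightarrow> A \<in> \<Psi> y \<Longrightarrow> norm A \<le> M"
    by (rule locally_bounded_at_norm[of \<Psi> x])
      (use assms in \<open>auto simp: semismooth_at_def semismooth_on_def\<close>)
  obtain r' where r': "r' > 0" "ball x r' \<subseteq> \<Omega>" using assms openE by blast
  have "M-lipschitz_on (ball x (min r r')) (\<lambda>y. F y - 0 *v y)"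
    by (rule semismooth_on_lipschitz[OF assms(2)]) (use r r' in auto)
  then show ?thesis
    by (intro that[of "min r r'" M]) (use r r' in auto)
qed

lemma semismooth_on_isCont:
  assumes "open \<Omega>" "semismooth_on F \<Omega> \<Psi>" "x \<in> \<Omega>"
  shows "isCont F x"
  using semismooth_on_lipschitz_near[OF assms] lipschitz_on_continuous_on
  by (metis centre_in_ball continuous_on_eq_continuous_at open_ball)

section \<open>The closure of a multifunction\<close>

lemma subset_cl_mf: "\<Psi> x \<subseteq> cl_mf \<Psi> x"
  using closure_subset[of "gph \<Psi>"] by (auto simp: cl_mf_def gph_def)

lemma cl_mf_sequence:
  fixes \<Psi> :: "'a::metric_space \<Rightarrow> 'b::metric_space set"
  assumes "A \<in> cl_mf \<Psi> x"
  obtains X B where "\<And>k. B k \<in> \<Psi> (X k)" "X \<longlonglongrightarrow> x" "B \<longlonglongrightarrow> A"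
proof -
  obtain f where f: "\<And>k. f k \<in> gph \<Psi>" "f \<longlonglongrightarrow> (x, A)"
    using assms unfolding cl_mf_def closure_sequential by blast
  show ?thesis
  proof
    show "snd (f k) \<in> \<Psi> (fst (f k))" for k using f(1)[of k] by (auto simp: gph_def)
    show "(\<lambda>k. fst (f k)) \<longlonglongrightarrow> x" "(\<lambda>k. snd (f k)) \<longlonglongrightarrow> A"
      using tendsto_fst[OF f(2)] tendsto_snd[OF f(2)] by auto
  qed
qed

lemma cl_mfI:
  fixes \<Psi> :: "'a::metric_space \<Rightarrow> 'b::metric_space set"
  assumes "\<And>k. B k \<in> \<Psi> (X k)" "X \<longlonglongrightarrow> x" "B \<longlonglongrightarrow> A"
  shows "A \<in> cl_mf \<Psi> x"
  unfolding cl_mf_def closure_sequential mem_Collect_eq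
  using assms by (intro exI[of _ "\<lambda>k. (X k, B k)"]) (auto simp: gph_def intro: tendsto_Pair)

lemma cl_mf_subset:
  fixes \<Psi> :: "'a::metric_space \<Rightarrow> 'b::metric_space set"
  assumes "open U" "x \<in> U" "closed W" "\<And>y. y \<in> U \<Longrightarrow> \<Psi> y \<subseteq> W"
  shows "cl_mf \<Psi> x \<subseteq> W"
proof
  fix A assume "A \<in> cl_mf \<Psi> x"
  then obtain X B where *: "\<And>k. B k \<in> \<Psi> (X k)" "X \<longlonglongrightarrow> x" "B \<longlonglongrightarrow> A"
    by (rule cl_mf_sequence) blast
  have "\<forall>\<^sub>F k in sequentially. X k \<in> U"
    using *(2) assms(1,2) by (rule topological_tendstoD)
  then have "\<forall>\<^sub>F k in sequentially. B k \<in> W"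
    by (rule eventually_mono) (use * assms(4) in blast)
  from Lim_in_closed_set[OF assms(3) this _ *(3)] show "A \<in> W" by simp
qed

lemma closed_cl_mf: "closed (cl_mf \<Psi> x)"
proof -
  have "cl_mf \<Psi> x = Pair x -` closure (gph \<Psi>)" by (auto simp: cl_mf_def)
  moreover have "closed (Pair x -` closure (gph \<Psi>))"
    by (intro closed_vimage closed_closure continuous_intros)
  ultimately show ?thesis by simp
qed

lemma compact_cl_mf:
  fixes \<Psi> :: "real^'n \<Rightarrow> (real^'n^'m) set"
  assumes "locally_bounded_at \<Psi> x"
  shows "compact (cl_mf \<Psi> x)"
proof -
  obtain r M where r: "r > 0" "M \<ge> 0"
    "\<And>y A. y \<in> ball x r \<Longrightarrow> A \<in> \<Psi> y \<Longrightarrow> norm A \<le> M"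
    by (rule locally_bounded_at_norm[OF assms]) blast
  have "cl_mf \<Psi> x \<subseteq> cball 0 M"
    by (rule cl_mf_subset[of "ball x r"]) (use r in auto)
  then show ?thesis
    using closed_cl_mf bounded_subset[OF bounded_cball] compact_eq_bounded_closed by blast
qed

text \<open>Upper semicontinuity: matrices outside V taken at points tending to x would form a
  bounded sequence. A convergent subsequence has its limit in \<open>cl_mf \<Psi> x\<close> and, the
  complement of V being closed, outside V.\<close>

lemma cl_mf_usc:
  fixes \<Psi> :: "real^'n \<Rightarrow> (real^'n^'m) set"
  assumes "locally_bounded_at \<Psi> x" "open V" "cl_mf \<Psi> x \<subseteq> V"
  obtains d where "d > 0" "\<And>y. y \<in> ball x d \<Longrightarrow> \<Psi> y \<subseteq> V"
proof -
  obtain r M where r: "r > 0" "M \<ge> 0"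
    "\<And>y A. y \<in> ball x r \<Longrightarrow> A \<in> \<Psi> y \<Longrightarrow> norm A \<le> M"
    by (rule locally_bounded_at_norm[OF assms(1)]) blast
  have "\<exists>d>0. \<forall>y\<in>ball x d. \<Psi> y \<subseteq> V"
  proof (rule ccontr)
    assume "\<not> (\<exists>d>0. \<forall>y\<in>ball x d. \<Psi> y \<subseteq> V)"
    then have "\<exists>y B. y \<in> ball x (r / Suc k) \<and> B \<in> \<Psi> y \<and> B \<notin> V" for k :: nat
      using r(1) by (metis divide_pos_pos of_nat_0_less_iff subsetI zero_less_Suc)
    then obtain X B where XB: "\<And>k. X k \<in> ball x (r / Suc k)" "\<And>k. B k \<in> \<Psi> (X k)" "\<And>k. B k \<notin> V"
      by metis
    have "X \<longlonglongrightarrow> x"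
    proof (rule metric_tendsto_imp_tendsto)
      show "(\<lambda>k. r / Suc k) \<longlonglongrightarrow> 0"
        using LIMSEQ_Suc[OF lim_const_over_n[of r]] by simp
      show "\<forall>\<^sub>F k in sequentially. dist (X k) x \<le> dist (r / Suc k) 0"
        using XB(1) r(1) by (intro always_eventually) (auto simp: dist_commute less_imp_le)
    qed
    have "norm (B k) \<le> M" for k
    proof (rule r(3)[OF _ XB(2)])
      have "r / Suc k \<le> r" using r(1) by (simp add: divide_simps)
      then show "X k \<in> ball x r" using XB(1)[of k] by simp
    qed
    then have "B k \<in> cball 0 M" for k by simp
    then obtain A s where "strict_mono (s :: nat \<Rightarrow> nat)" and lim: "(B \<circ> s) \<longlonglongrightarrow> A"
      using compact_cball unfolding compact_def by metis
    have "A \<in> cl_mf \<Psi> x"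
    proof (rule cl_mfI)
      show "(X \<circ> s) \<longlonglongrightarrow> x" by (rule LIMSEQ_subseq_LIMSEQ) fact+
      show "(B \<circ> s) k \<in> \<Psi> ((X \<circ> s) k)" for k by (simp add: XB)
    qed fact
    moreover have "A \<in> - V"
      by (rule closed_sequentially[OF _ _ lim]) (use assms(2) XB(3) in auto)
    ultimately show False using assms(3) by blast
  qed
  then show ?thesis using that by blast
qed

text \<open>The estimate is a closed condition on the pair (x, A), because F is already known to be
  continuous on \<Omega>. It therefore survives the passage from the graph to its closure.\<close>

lemma semismooth_on_eventually_cl_mf:
  fixes \<Psi> :: "real^'n \<Rightarrow> (real^'n^'m) set"
  assumes "open \<Omega>" "semismooth_on F \<Omega> \<Psi>" "x0 \<in> \<Omega>" "e > 0"
  shows "\<forall>\<^sub>F x in at x0. \<forall>A\<in>cl_mf \<Psi> x. norm (F x - F x0 - A *v (x - x0)) \<le> e * norm (x - x0)"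
proof -
  have "\<forall>\<^sub>F x in at x0. \<forall>A\<in>\<Psi> x. norm (F x - F x0 - A *v (x - x0)) \<le> e * norm (x - x0)"
    using semismooth_at_eventually[of F \<Omega> \<Psi> x0 e] assms at_within_open[of x0 \<Omega>]
    by (auto simp: semismooth_on_def)
  then obtain d where d: "d > 0"
    "\<And>x A. x \<noteq> x0 \<Longrightarrow> dist x x0 < d \<Longrightarrow> A \<in> \<Psi> x \<Longrightarrow> norm (F x - F x0 - A *v (x - x0)) \<le> e * norm (x - x0)"
    unfolding eventually_at by blast
  have "\<forall>\<^sub>F x in at x0. x \<in> \<Omega> \<inter> ball x0 d - {x0}"
    using eventually_at_in_open[of "\<Omega> \<inter> ball x0 d" x0] assms d(1) by auto
  then show ?thesis
  proof (rule eventually_mono; intro ballI)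
    fix x A assume x: "x \<in> \<Omega> \<inter> ball x0 d - {x0}" and "A \<in> cl_mf \<Psi> x"
    obtain X B where *: "\<And>k. B k \<in> \<Psi> (X k)" "X \<longlonglongrightarrow> x" "B \<longlonglongrightarrow> A"
      using \<open>A \<in> cl_mf \<Psi> x\<close> by (rule cl_mf_sequence) blast
    have F: "(\<lambda>k. F (X k)) \<longlonglongrightarrow> F x"
      using semismooth_on_isCont[OF assms(1,2)] x *(2) isCont_tendsto_compose by blast
    have "(\<lambda>k. B k *v (X k - x0)) \<longlonglongrightarrow> A *v (x - x0)"
      unfolding matrix_vector_mult_def
      by (intro tendsto_vec_lambda tendsto_sum tendsto_mult tendsto_vec_nth tendsto_diff tendsto_const *)
    then have 1: "(\<lambda>k. norm (F (X k) - F x0 - B k *v (X k - x0))) \<longlonglongrightarrow> norm (F x - F x0 - A *v (x - x0))"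
      by (intro tendsto_intros F)
    have 2: "(\<lambda>k. e * norm (X k - x0)) \<longlonglongrightarrow> e * norm (x - x0)"
      by (intro tendsto_intros *)
    \<comment> \<open>The point x differs from x0, so the approximating points eventually avoid x0
      too, and the estimate for \<open>\<Psi>\<close> applies to them.\<close>
    have "\<forall>\<^sub>F k in sequentially. X k \<in> ball x0 d - {x0}"
      using *(2) by (rule topological_tendstoD) (use x in auto)
    then have "\<forall>\<^sub>F k in sequentially. norm (F (X k) - F x0 - B k *v (X k - x0)) \<le> e * norm (X k - x0)"
      by (rule eventually_mono) (use d(2) *(1) in \<open>auto simp: dist_commute\<close>)
    from tendsto_le[OF _ 2 1 this]
    show "norm (F x - F x0 - A *v (x - x0)) \<le> e * norm (x - x0)" by simp
  qed
qed

section \<open>Strict differentiability where the closure is single-valued\<close>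

text \<open>By upper semicontinuity all matrices of \<open>\<Psi>\<close> near x lie within e of A,
  so F - A is e-Lipschitz on a ball around x. This bound is uniform in both points of the ball:
  leaving both free gives the strict derivative, fixing one at x the Frechet derivative.\<close>

lemma singleton_strictly_differentiable:
  fixes \<Psi> :: "real^'n \<Rightarrow> (real^'n^'m) set"
  assumes "open \<Omega>" "semismooth_on F \<Omega> \<Psi>" "x \<in> \<Omega>" and cl: "cl_mf \<Psi> x = {A}"
  shows "strictly_differentiable_at F \<Omega> x" and "(F has_derivative (\<lambda>v. A *v v)) (at x)"
proof -
  have "locally_bounded_at \<Psi> x" using assms by (auto simp: semismooth_on_def semismooth_at_def)
  obtain r where r: "r > 0" "ball x r \<subseteq> \<Omega>" using assms openE by blast
  have small: "\<exists>d>0. \<forall>y\<in>ball x d. \<forall>z\<in>ball x d. norm (F z - F y - A *v (z - y)) \<le> e * norm (z - y)"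
    if "e > 0" for e
  proof -
    obtain d where d: "d > 0" "\<And>y. y \<in> ball x d \<Longrightarrow> \<Psi> y \<subseteq> ball A e"
      by (rule cl_mf_usc[OF \<open>locally_bounded_at \<Psi> x\<close>, of "ball A e"]) (use cl \<open>e > 0\<close> in auto)
    have lip: "e-lipschitz_on (ball x (min d r)) (\<lambda>y. F y - A *v y)"
    proof (rule semismooth_on_lipschitz[OF assms(2)])
      fix y B assume "y \<in> ball x (min d r)" "B \<in> \<Psi> y"
      then have "B \<in> ball A e" using d(2)[of y] by auto
      then show "norm (B - A) \<le> e" by (simp add: dist_norm norm_minus_commute)
    qed (use r \<open>e > 0\<close> in auto)
    have "norm (F z - F y - A *v (z - y)) \<le> e * norm (z - y)"
      if "y \<in> ball x (min d r)" "z \<in> ball x (min d r)" for y z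
      using lipschitz_onD[OF lip that] by (simp add: dist_norm algebra_simps norm_minus_commute)
    then show ?thesis using d(1) r(1) by (intro exI[of _ "min d r"]) auto
  qed
  have "((\<lambda>(y, t). (F (y + t *\<^sub>R u) - F y) /\<^sub>R t) \<longlongrightarrow> A *v u) (nhds x \<times>\<^sub>F at_right 0)" for u
  proof (rule tendstoI)
    fix e :: real assume "e > 0"
    \<comment> \<open>The summand 1 covers u = 0 and makes \<open>e' * norm u < e\<close>
      strict.\<close>
    define e' where "e' = e / (norm u + 1)"
    have e': "e' > 0" "e' * norm u < e"
      using \<open>e > 0\<close> by (auto simp: e'_def divide_simps add_nonneg_pos)
    obtain d where d: "d > 0"
      "\<And>y z. y \<in> ball x d \<Longrightarrow> z \<in> ball x d \<Longrightarrow> norm (F z - F y - A *v (z - y)) \<le> e' * norm (z - y)"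
      using small[OF e'(1)] by blast
    have "((\<lambda>p. fst p + snd p *\<^sub>R u) \<longlongrightarrow> x + 0 *\<^sub>R u) (nhds x \<times>\<^sub>F at_right 0)"
      by (intro tendsto_intros filterlim_compose[OF filterlim_ident filterlim_fst]
          filterlim_mono[OF filterlim_snd _ order_refl] at_within_le_nhds)
    then have 1: "\<forall>\<^sub>F p in nhds x \<times>\<^sub>F at_right 0. fst p + snd p *\<^sub>R u \<in> ball x d"
      by (rule topological_tendstoD) (use d(1) in auto)
    have 2: "\<forall>\<^sub>F p in nhds x \<times>\<^sub>F at_right 0. fst p \<in> ball x d"
      by (rule topological_tendstoD[OF filterlim_fst]) (use d(1) in auto)
    have 3: "\<forall>\<^sub>F p in nhds x \<times>\<^sub>F at_right 0. snd p > (0::real)"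
      by (rule eventually_compose_filterlim[OF eventually_at_right_less filterlim_snd])
    from 1 2 3 show "\<forall>\<^sub>F p in nhds x \<times>\<^sub>F at_right 0. dist (case p of (y, t) \<Rightarrow> (F (y + t *\<^sub>R u) - F y) /\<^sub>R t) (A *v u) < e"
    proof eventually_elim
      case (elim p)
      obtain y t where p: "p = (y, t)" by fastforce
      have "(F (y + t *\<^sub>R u) - F y) /\<^sub>R t - A *v u = (F (y + t *\<^sub>R u) - F y - A *v (t *\<^sub>R u)) /\<^sub>R t"
        using elim p by (simp add: scaleR_diff_right matrix_vector_mult_scaleR)
      also have "norm \<dots> = norm (F (y + t *\<^sub>R u) - F y - A *v (t *\<^sub>R u)) / t"
        using elim p by (simp add: divide_inverse)
      also have "\<dots> \<le> (e' * norm (t *\<^sub>R u)) / t"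
        using elim p d(2)[of y "y + t *\<^sub>R u"] by (intro divide_right_mono) auto
      also have "\<dots> < e" using elim p e'(2) by simp
      finally show ?case by (simp add: p dist_norm)
    qed
  qed
  moreover have "lipschitz_near F \<Omega> x"
    using semismooth_on_lipschitz_near[OF assms(1-3)] unfolding lipschitz_near_def
    by (metis centre_in_ball inf.absorb1 open_ball)
  ultimately show "strictly_differentiable_at F \<Omega> x"
    unfolding strictly_differentiable_at_def by blast
  show "(F has_derivative (\<lambda>v. A *v v)) (at x)"
    unfolding has_derivative_at_alt
  proof (intro conjI allI impI)
    fix e :: real assume "e > 0"
    from small[OF this] obtain d where "d > 0"
      "\<forall>y\<in>ball x d. \<forall>z\<in>ball x d. norm (F z - F y - A *v (z - y)) \<le> e * norm (z - y)" by blast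
    then show "\<exists>d>0. \<forall>y. norm (y - x) < d \<longrightarrow> norm (F y - F x - A *v (y - x)) \<le> e * norm (y - x)"
      by (intro exI[of _ d]) (auto simp: dist_norm norm_minus_commute[of x])
  qed simp
qed

section \<open>Averages of the divergence, and null sets\<close>

text \<open>Instead of rotating coordinates so that e becomes an axis, the translates of N by -t e
  are averaged over t in [0,1]. Each has the measure of N, and exchanging the integrals leaves inner
  integrals over countable sets of t. This form covers every e, even e = 0.\<close>

lemma null_sets_of_countable_on_lines:
  fixes N :: "'a::euclidean_space set" and e :: 'a
  assumes N: "N \<in> sets borel" and line: "\<And>y. countable {t::real. y + t *\<^sub>R e \<in> N}"
  shows "N \<in> null_sets lborel"
proof -
  have [measurable]: "(\<lambda>(y, t). indicator N (y + t *\<^sub>R e) * indicator {0..1} t :: ennreal)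
      \<in> borel_measurable (lborel \<Otimes>\<^sub>M (lborel :: real measure))"
    using N by measurable
  have shift: "(\<integral>\<^sup>+y. indicator N (y + t *\<^sub>R e) \<partial>lborel) = emeasure lborel N" for t :: real
  proof -
    have "(\<integral>\<^sup>+y. indicator N (y + t *\<^sub>R e) \<partial>lborel)
        = (\<integral>\<^sup>+y. indicator N y \<partial>distr lborel borel ((+) (t *\<^sub>R e)))"
      using N by (subst nn_integral_distr) (auto simp: add.commute)
    then show ?thesis using N by (simp add: lborel_distr_plus)
  qed
  have "emeasure lborel N = (\<integral>\<^sup>+t. emeasure lborel N * indicator {0..1::real} t \<partial>lborel)"
    by (simp add: nn_integral_cmult_indicator)
  also have "\<dots> = (\<integral>\<^sup>+t. (\<integral>\<^sup>+y. indicator N (y + t *\<^sub>R e) * indicator {0..1} t \<partial>lborel) \<partial>lborel)"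
    using N by (intro nn_integral_cong) (simp add: nn_integral_multc shift)
  also have "\<dots> = (\<integral>\<^sup>+y. (\<integral>\<^sup>+t. indicator N (y + t *\<^sub>R e) * indicator {0..1} t \<partial>lborel) \<partial>lborel)"
    by (subst lborel_pair.Fubini') auto
  also have "\<dots> = (\<integral>\<^sup>+(y::'a). 0 \<partial>lborel)"
  proof (intro nn_integral_cong)
    fix y :: 'a
    have "AE t in lborel. t \<notin> {t. y + t *\<^sub>R e \<in> N}"
      by (intro AE_not_in countable_imp_null_set_lborel line)
    then have "AE t in lborel. indicator N (y + t *\<^sub>R e) * indicator {0..1} t = (0::ennreal)"
      by eventually_elim auto
    then show "(\<integral>\<^sup>+t. indicator N (y + t *\<^sub>R e) * indicator {0..1} t \<partial>lborel) = 0"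
      by (subst nn_integral_cong_AE[where v = "\<lambda>_. 0"]) auto
  qed
  finally show ?thesis using N by auto
qed

text \<open>The difference quotients of the field are tested against the tent function
  \<open>y \<mapsto> max 0 (1 - dist x y / r)\<close>. Shifting them onto the tent function, whose Lipschitz
  constant is \<open>1 / r\<close>, bounds the integral by \<open>o(r ^ DIM('a))\<close>.\<close>

lemma divergence_le_0:
  fixes G :: "'a::euclidean_space \<Rightarrow> 'a"
  assumes "\<delta> > 0" and lip: "L-lipschitz_on (ball x \<delta>) G"
    and ae: "AE y in lborel. y \<in> ball x \<delta> \<longrightarrow>
      (\<exists>D. (G has_derivative D) (at y) \<and> b \<le> (\<Sum>e\<in>Basis. D e \<bullet> e))"
    and der: "(G has_derivative (\<lambda>v. 0)) (at x)" and G0: "G x = 0"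
  shows "b \<le> 0"
proof (rule ccontr)
  assume "\<not> b \<le> 0"
  then have "b > 0" by simp
  define n where "n = DIM('a)"
  \<comment> \<open>Chosen so that the upper bound \<open>n * (2 * \<epsilon> * 2 ^ n * V)\<close>
    found below is a quarter of the lower bound \<open>b * ((1/2) ^ n * V / 2)\<close>.\<close>
  define \<epsilon> where "\<epsilon> = b / (16 * n * 4 ^ n)"
  have "n > 0" by (simp add: n_def)
  then have "\<epsilon> > 0" using \<open>b > 0\<close> by (simp add: \<epsilon>_def)
  obtain d where d: "d > 0" "\<And>y. norm (y - x) < d \<Longrightarrow> norm (G y) \<le> \<epsilon> * norm (y - x)"
    using der \<open>\<epsilon> > 0\<close> G0 unfolding has_derivative_at_alt by auto
  \<comment> \<open>A point of the ball of radius r, shifted by at most r, stays in the ball of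
    radius 2r, where both the Lipschitz bound and the bound by \<epsilon> are available.\<close>
  define r where "r = min d \<delta> / 3"
  have r: "r > 0" "2 * r < d" "2 * r < \<delta>" using d(1) \<open>\<delta> > 0\<close> by (auto simp: r_def)
  define V where "V = measure lborel (ball x r)"
  have "V > 0" using r by (simp add: V_def)
  have scale: "measure lborel (ball x (c * r)) = c ^ n * V" if "c \<ge> 0" for c
    using that r by (simp add: V_def content_ball n_def power_mult_distrib)
  \<comment> \<open>Cutting G off makes it bounded and measurable on the whole space, so that
    integrals can be translated freely. Inside the ball of radius 2r nothing changes.\<close>
  define H where "H y = indicator (ball x (2 * r)) y *\<^sub>R G y" for y
  have H_meas [measurable]: "H \<in> borel_measurable borel"
    unfolding H_def
  proof (rule borel_measurable_continuous_on_indicator)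
    show "continuous_on (ball x (2 * r)) G"
      by (rule continuous_on_subset[OF lipschitz_on_continuous_on[OF lip]]) (use r in auto)
  qed simp
  have H_bound: "norm (H y) \<le> 2 * r * \<epsilon>" for y
  proof (cases "y \<in> ball x (2 * r)")
    case True
    then have "norm (G y) \<le> \<epsilon> * norm (y - x)"
      using r by (intro d(2)) (auto simp: dist_norm norm_minus_commute)
    also have "\<dots> \<le> \<epsilon> * (2 * r)"
      using True \<open>\<epsilon> > 0\<close> by (intro mult_left_mono) (auto simp: dist_norm norm_minus_commute)
    finally show ?thesis using True by (simp add: H_def mult_ac)
  qed (use r \<open>\<epsilon> > 0\<close> in \<open>simp add: H_def\<close>)
  define \<phi> where "\<phi> y = max 0 (1 - dist x y / r)" for y
  have \<phi>_meas [measurable]: "\<phi> \<in> borel_measurable borel"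
    unfolding \<phi>_def by measurable
  have \<phi>_range: "0 \<le> \<phi> y" "\<phi> y \<le> indicator (ball x r) y" for y
    using r by (auto simp: \<phi>_def indicator_def field_simps)
  have \<phi>_lip: "\<bar>\<phi> y - \<phi> z\<bar> \<le> dist y z / r" for y z
  proof -
    have "\<bar>\<phi> y - \<phi> z\<bar> \<le> \<bar>dist x y / r - dist x z / r\<bar>" by (simp add: \<phi>_def max_def abs_if)
    also have "\<dots> = \<bar>dist x y - dist x z\<bar> / r" using r by (simp add: diff_divide_distrib[symmetric])
    also have "\<dots> \<le> dist y z / r"
      using r by (intro divide_right_mono) (auto simp: abs_le_iff, metric, metric)
    finally show ?thesis .
  qed
  have int_ball: "integrable lborel (\<lambda>y. c * indicator (ball x s) y :: real)" for c s
    using emeasure_bounded_finite[OF bounded_ball, of x s]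
    by (intro integrable_mult_right integrable_real_indicator) auto
  have int_\<phi>: "integrable lborel \<phi>"
  proof (rule Bochner_Integration.integrable_bound[OF int_ball[of 1 r]])
    show "AE y in lborel. norm (\<phi> y) \<le> norm (1 * indicator (ball x r) y :: real)"
      using \<phi>_range by (intro AE_I2) (simp add: abs_of_nonneg del: indicator_simps)
  qed simp
  \<comment> \<open>The tent is at least 1/2 on the ball of half the radius; this bounds its
    integral from below by a fixed fraction of V.\<close>
  have \<phi>_ge: "(1/2) * indicator (ball x (1/2 * r)) y \<le> \<phi> y" for y
  proof (cases "y \<in> ball x (1/2 * r)")
    case True
    then have "dist x y / r \<le> 1/2" using r by (simp add: pos_divide_le_eq)
    then have "1/2 \<le> \<phi> y" unfolding \<phi>_def by linarith
    then show ?thesis using True by simp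
  next
    case False
    then show ?thesis using \<phi>_range(1)[of y] by simp
  qed
  have \<phi>_lower: "(1/2) ^ n * V / 2 \<le> (\<integral>y. \<phi> y \<partial>lborel)"
  proof -
    have "(1/2) ^ n * V / 2 = (\<integral>y. (1/2) * indicator (ball x (1/2 * r)) y \<partial>lborel)"
      using scale[of "1/2"] by simp
    also have "\<dots> \<le> (\<integral>y. \<phi> y \<partial>lborel)"
      by (rule integral_mono[OF int_ball int_\<phi>]) (rule \<phi>_ge)
    finally show ?thesis .
  qed
  define h where "h k = r / Suc k" for k :: nat
  have h: "h k > 0" "h k \<le> r" for k using r by (auto simp: h_def divide_simps)
  have h_lim: "h \<longlonglongrightarrow> 0"
    unfolding h_def using LIMSEQ_Suc[OF lim_const_over_n[of r]] by simp
  \<comment> \<open>A discrete divergence weighted by the tent, with forward difference quotients of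
    step \<open>h k\<close>. Where \<phi> is nonzero, both points of each quotient lie in the ball
    of radius 2r, so the Lipschitz constant of G gives a bound independent of k.\<close>
  define q where "q k y = (\<Sum>e\<in>Basis. \<phi> y * ((H (y + h k *\<^sub>R e) - H y) \<bullet> e / h k))" for k y
  have q_meas [measurable]: "q k \<in> borel_measurable borel" for k
    unfolding q_def by measurable
  have L0: "L \<ge> 0" using lip by (rule lipschitz_on_nonneg)
  have q_bound: "norm (q k y) \<le> (n * L) * indicator (ball x r) y" for k y
  proof (cases "y \<in> ball x r")
    case True
    have "\<bar>\<phi> y * ((H (y + h k *\<^sub>R e) - H y) \<bullet> e / h k)\<bar> \<le> 1 * L" if e: "e \<in> Basis" for e
    proof -
      have 1: "dist y (y + h k *\<^sub>R e) = h k" using h[of k] e by (simp add: dist_norm)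
      have 2: "y + h k *\<^sub>R e \<in> ball x (2 * r)" "y \<in> ball x (2 * r)"
        using True h[of k] 1 dist_triangle[of x "y + h k *\<^sub>R e" y] r by auto
      have "norm (G (y + h k *\<^sub>R e) - G y) \<le> L * h k"
        using lipschitz_onD[OF lip, of y "y + h k *\<^sub>R e"] 1 2 r
        by (simp add: dist_norm norm_minus_commute)
      then have "\<bar>(H (y + h k *\<^sub>R e) - H y) \<bullet> e\<bar> \<le> L * h k"
        using Basis_le_norm[OF e, of "H (y + h k *\<^sub>R e) - H y"] 2 by (simp add: H_def)
      then have "\<bar>(H (y + h k *\<^sub>R e) - H y) \<bullet> e / h k\<bar> \<le> L"
        using h[of k] by (simp add: divide_simps)
      then show ?thesis
        unfolding abs_mult using \<phi>_range[of y] True by (intro mult_mono) auto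
    qed
    then have "norm (q k y) \<le> (\<Sum>e\<in>(Basis::'a set). L)"
      unfolding q_def by (simp only: real_norm_def) (intro sum_abs[THEN order_trans] sum_mono, simp)
    then show ?thesis using True by (simp add: n_def)
  next
    case False
    then have "\<phi> y = 0" using \<phi>_range[of y] by auto
    then show ?thesis using L0 by (simp add: q_def)
  qed
  have int_q: "integrable lborel (q k)" for k
    by (rule Bochner_Integration.integrable_bound[OF int_ball[of "n * L" r]])
      (use q_bound[of k] L0 in auto)
  \<comment> \<open>Summation by parts: translating the first term moves the difference onto \<phi>.
    There it is at most \<open>h k / r\<close>, while \<open>H y \<bullet> e / h k\<close> is at
    most \<open>2 * r * \<epsilon> / h k\<close>; the step and the radius cancel.\<close>
  have upper: "(\<integral>y. q k y \<partial>lborel) \<le> n * (2 * \<epsilon> * 2 ^ n * V)" for k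
  proof -
    have int_H: "integrable lborel (\<lambda>y. \<phi> y * (H (y + c) \<bullet> e / h k))"
      and int_H': "integrable lborel (\<lambda>y. \<phi> (y + c) * (H y \<bullet> e / h k))" for c e :: 'a
    proof -
      have bound: "\<bar>H z \<bullet> e\<bar> \<le> 2 * r * \<epsilon> * norm e" for z
        by (rule order_trans[OF Cauchy_Schwarz_ineq2]) (simp add: H_bound mult_right_mono)
      have *: "\<bar>\<phi> y * (H z \<bullet> e / h k)\<bar> \<le> 2 * r * \<epsilon> * norm e / h k * indicator (ball x r) y" for y z
        using mult_mono[OF \<phi>_range(2)[of y] divide_right_mono[OF bound[of z], of "h k"]]
          h[of k] \<phi>_range[of y] by (simp add: abs_mult mult.commute)
      have bm: "(\<lambda>y. \<phi> y * (H (y + a) \<bullet> e / h k)) \<in> borel_measurable lborel" for a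
        by simp
      show "integrable lborel (\<lambda>y. \<phi> y * (H (y + c) \<bullet> e / h k))"
        by (rule Bochner_Integration.integrable_bound[OF int_ball[of "2 * r * \<epsilon> * norm e / h k" r]])
          (use bm in \<open>simp_all only: real_norm_def AE_I2[OF order_trans[OF * abs_ge_self]]\<close>)
      have "integrable (distr lborel borel ((+) c)) (\<lambda>y. \<phi> y * (H (y + - c) \<bullet> e / h k))"
        unfolding lborel_distr_plus
        by (rule Bochner_Integration.integrable_bound[OF int_ball[of "2 * r * \<epsilon> * norm e / h k" r]])
          (use bm in \<open>simp_all only: real_norm_def AE_I2[OF order_trans[OF * abs_ge_self]]\<close>)
      then show "integrable lborel (\<lambda>y. \<phi> (y + c) * (H y \<bullet> e / h k))"
        by (subst (asm) integrable_distr_eq) (auto simp: add.commute)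
    qed
    have "(\<integral>y. q k y \<partial>lborel)
        = (\<Sum>e\<in>Basis. \<integral>y. \<phi> y * ((H (y + h k *\<^sub>R e) - H y) \<bullet> e / h k) \<partial>lborel)"
      unfolding q_def
    proof (intro Bochner_Integration.integral_sum)
      fix e :: 'a
      show "integrable lborel (\<lambda>y. \<phi> y * ((H (y + h k *\<^sub>R e) - H y) \<bullet> e / h k))"
        using Bochner_Integration.integrable_diff[OF int_H[of "h k *\<^sub>R e" e] int_H[of 0 e]]
        by (simp add: inner_diff_left diff_divide_distrib right_diff_distrib)
    qed
    also have "\<dots> \<le> (\<Sum>e\<in>(Basis::'a set). 2 * \<epsilon> * 2 ^ n * V)"
    proof (intro sum_mono)
      fix e :: 'a assume e: "e \<in> Basis"
      define c where "c = h k *\<^sub>R e"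
      have shift: "(\<integral>y. \<phi> y * (H (y + c) \<bullet> e / h k) \<partial>lborel)
          = (\<integral>y. \<phi> (y - c) * (H y \<bullet> e / h k) \<partial>lborel)"
      proof -
        have "(\<integral>y. \<phi> (y - c) * (H y \<bullet> e / h k) \<partial>lborel)
            = (\<integral>y. \<phi> (y - c) * (H y \<bullet> e / h k) \<partial>distr lborel borel ((+) c))"
          by (simp add: lborel_distr_plus)
        also have "\<dots> = (\<integral>y. \<phi> y * (H (y + c) \<bullet> e / h k) \<partial>lborel)"
          by (subst integral_distr) (auto simp: add.commute)
        finally show ?thesis ..
      qed
      have "(\<integral>y. \<phi> y * ((H (y + c) - H y) \<bullet> e / h k) \<partial>lborel)
          = (\<integral>y. \<phi> y * (H (y + c) \<bullet> e / h k) \<partial>lborel) - (\<integral>y. \<phi> y * (H y \<bullet> e / h k) \<partial>lborel)"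
        using Bochner_Integration.integral_diff[OF int_H[of c e] int_H[of 0 e]]
        by (simp add: inner_diff_left diff_divide_distrib right_diff_distrib)
      also have "\<dots> = (\<integral>y. (\<phi> (y - c) - \<phi> y) * (H y \<bullet> e / h k) \<partial>lborel)"
        unfolding shift
        using Bochner_Integration.integral_diff[OF int_H'[of "- c" e] int_H[of 0 e]]
        by (simp add: left_diff_distrib diff_divide_distrib)
      also have "\<dots> \<le> (\<integral>y. 2 * \<epsilon> * indicator (ball x (2 * r)) y \<partial>lborel)"
      proof (rule integral_mono[OF _ int_ball])
        show "integrable lborel (\<lambda>y. (\<phi> (y - c) - \<phi> y) * (H y \<bullet> e / h k))"
          using Bochner_Integration.integrable_diff[OF int_H'[of "- c" e] int_H[of 0 e]]
          by (simp add: left_diff_distrib diff_divide_distrib)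
        fix y
        show "(\<phi> (y - c) - \<phi> y) * (H y \<bullet> e / h k) \<le> 2 * \<epsilon> * indicator (ball x (2 * r)) y"
        proof (cases "y \<in> ball x (2 * r)")
          case True
          have "\<bar>\<phi> (y - c) - \<phi> y\<bar> \<le> h k / r"
            using \<phi>_lip[of "y - c" y] h[of k] e by (simp add: dist_norm c_def)
          moreover have "\<bar>H y \<bullet> e / h k\<bar> \<le> 2 * r * \<epsilon> / h k"
            using Basis_le_norm[OF e, of "H y"] H_bound[of y] h[of k]
            by (simp add: divide_right_mono)
          ultimately have "\<bar>(\<phi> (y - c) - \<phi> y) * (H y \<bullet> e / h k)\<bar> \<le> (h k / r) * (2 * r * \<epsilon> / h k)"
            unfolding abs_mult using h[of k] r by (intro mult_mono) auto
          also have "\<dots> = 2 * \<epsilon>" using h[of k] r by simp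
          finally have "(\<phi> (y - c) - \<phi> y) * (H y \<bullet> e / h k) \<le> 2 * \<epsilon>" by linarith
          then show ?thesis using True by simp
        qed (simp add: H_def)
      qed
      also have "\<dots> = 2 * \<epsilon> * 2 ^ n * V"
        using scale[of 2] by simp
      finally show "(\<integral>y. \<phi> y * ((H (y + h k *\<^sub>R e) - H y) \<bullet> e / h k) \<partial>lborel) \<le> 2 * \<epsilon> * 2 ^ n * V"
        by (simp add: c_def)
    qed
    finally show ?thesis by (simp add: n_def)
  qed
  \<comment> \<open>Taking \<open>lim\<close> makes the pointwise limit measurable without a
    measurable choice of derivatives. Its arbitrary values where the sequence diverges concern only
    a null set.\<close>
  define f where "f y = lim (\<lambda>k. q k y)" for y
  have conv: "AE y in lborel. (\<lambda>k. q k y) \<longlonglongrightarrow> f y \<and> b * \<phi> y \<le> f y"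
    using ae
  proof eventually_elim
    case (elim y)
    show ?case
    proof (cases "y \<in> ball x r")
      case True
      then have "y \<in> ball x \<delta>" using r by auto
      then obtain D where D: "(G has_derivative D) (at y)" "b \<le> (\<Sum>e\<in>Basis. D e \<bullet> e)"
        using elim by blast
      have "(H has_derivative D) (at y)"
      proof (rule has_derivative_transform_within_open[OF D(1)])
        show "open (ball x (2 * r))" "y \<in> ball x (2 * r)" using True r by auto
      qed (simp add: H_def)
      then interpret D: bounded_linear D by (rule has_derivative_bounded_linear)
      have "(\<lambda>k. q k y) \<longlonglongrightarrow> (\<Sum>e\<in>Basis. \<phi> y * (D e \<bullet> e))"
        unfolding q_def
      proof (intro tendsto_sum tendsto_mult tendsto_const)
        fix e :: 'a
        have "((\<lambda>t. H (y + t *\<^sub>R e)) has_derivative (\<lambda>t. D (t *\<^sub>R e))) (at 0)"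
          by (rule has_derivative_compose[of "\<lambda>t. y + t *\<^sub>R e" _ 0 UNIV H D, simplified])
            (auto intro!: derivative_eq_intros \<open>(H has_derivative D) (at y)\<close>)
        then have "((\<lambda>t. norm (H (y + t *\<^sub>R e) - H y - t *\<^sub>R D e) / norm t) \<longlongrightarrow> 0) (at 0)"
          by (simp add: has_derivative_at D.scaleR)
        moreover have "\<forall>\<^sub>F t in at 0. norm (H (y + t *\<^sub>R e) - H y - t *\<^sub>R D e) / norm t
            = norm ((H (y + t *\<^sub>R e) - H y) /\<^sub>R t - D e)"
          unfolding eventually_at_filter
        proof (intro always_eventually allI impI)
          fix t :: real assume "t \<noteq> 0"
          then have "(H (y + t *\<^sub>R e) - H y) /\<^sub>R t - D e = (H (y + t *\<^sub>R e) - H y - t *\<^sub>R D e) /\<^sub>R t"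
            by (simp add: scaleR_diff_right)
          then show "norm (H (y + t *\<^sub>R e) - H y - t *\<^sub>R D e) / norm t
            = norm ((H (y + t *\<^sub>R e) - H y) /\<^sub>R t - D e)" by (simp add: divide_inverse)
        qed
        ultimately have "((\<lambda>t. norm ((H (y + t *\<^sub>R e) - H y) /\<^sub>R t - D e)) \<longlongrightarrow> 0) (at 0)"
          by (rule Lim_transform_eventually)
        then have "((\<lambda>t. (H (y + t *\<^sub>R e) - H y) /\<^sub>R t) \<longlongrightarrow> D e) (at 0)"
          by (rule LIM_zero_cancel[OF tendsto_norm_zero_cancel])
        moreover have "filterlim h (at 0) sequentially"
          using h_lim h(1) by (auto simp: filterlim_at intro!: always_eventually less_imp_neq[THEN not_sym])
        ultimately have "(\<lambda>k. (H (y + h k *\<^sub>R e) - H y) /\<^sub>R h k) \<longlonglongrightarrow> D e"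
          by (rule filterlim_compose)
        from tendsto_inner[OF this tendsto_const[of e]]
        show "(\<lambda>k. (H (y + h k *\<^sub>R e) - H y) \<bullet> e / h k) \<longlonglongrightarrow> D e \<bullet> e"
          by (simp add: divide_inverse mult.commute)
      qed
      moreover from this have "f y = (\<Sum>e\<in>Basis. \<phi> y * (D e \<bullet> e))"
        unfolding f_def by (rule limI)
      moreover have "\<phi> y * b \<le> \<phi> y * (\<Sum>e\<in>Basis. D e \<bullet> e)"
        using D(2) \<phi>_range by (intro mult_left_mono) auto
      ultimately show ?thesis by (simp add: sum_distrib_left mult.commute)
    next
      case False
      then have "\<phi> y = 0" using \<phi>_range[of y] by auto
      then show ?thesis by (simp add: f_def q_def)
    qed
  qed
  have f_meas [measurable]: "f \<in> borel_measurable borel" unfolding f_def by measurable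
  have conv': "AE y in lborel. (\<lambda>k. q k y) \<longlonglongrightarrow> f y" using conv by eventually_elim simp
  have qb: "AE y in lborel. norm (q k y) \<le> (n * L) * indicator (ball x r) y" for k
    using q_bound by simp
  \<comment> \<open>Dominated convergence carries the upper bound over to the integral of f, which
    almost everywhere is at least \<open>b * \<phi>\<close>. The two estimates clash by the choice
    of \<epsilon>.\<close>
  have "(\<lambda>k. \<integral>y. q k y \<partial>lborel) \<longlonglongrightarrow> (\<integral>y. f y \<partial>lborel)"
    by (rule integral_dominated_convergence[OF _ _ int_ball[of "n * L" r] conv' qb]) auto
  then have "(\<integral>y. f y \<partial>lborel) \<le> n * (2 * \<epsilon> * 2 ^ n * V)"
    by (rule LIMSEQ_le_const2) (use upper in auto)
  moreover have "b * (\<integral>y. \<phi> y \<partial>lborel) \<le> (\<integral>y. f y \<partial>lborel)"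
  proof -
    have "integrable lborel f"
      by (rule integrable_dominated_convergence[OF _ _ int_ball[of "n * L" r] conv' qb]) auto
    then have "(\<integral>y. b * \<phi> y \<partial>lborel) \<le> (\<integral>y. f y \<partial>lborel)"
      by (intro integral_mono_AE integrable_mult_right int_\<phi>) (use conv in auto)
    then show ?thesis by simp
  qed
  moreover have "b * ((1/2) ^ n * V / 2) \<le> b * (\<integral>y. \<phi> y \<partial>lborel)"
    using \<open>b > 0\<close> \<phi>_lower by (intro mult_left_mono) auto
  ultimately have "b * ((1/2) ^ n * V / 2) \<le> n * (2 * \<epsilon> * 2 ^ n * V)" by linarith
  also have "\<dots> = b * ((1/2) ^ n * V / 8)"
  proof -
    have "(4::real) ^ n = 2 ^ n * 2 ^ n" by (simp flip: power_mult_distrib)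
    then show ?thesis using \<open>n > 0\<close> by (simp add: \<epsilon>_def field_simps)
  qed
  finally show False using \<open>b > 0\<close> \<open>V > 0\<close> by simp
qed

text \<open>Subtracting the first-order expansion of G at x shifts every divergence by the same
  constant, the trace of D0, and leaves a field that vanishes to first order at x.\<close>

lemma divergence_ge:
  fixes G :: "'a::euclidean_space \<Rightarrow> 'a"
  assumes "\<delta> > 0" and lip: "L-lipschitz_on (ball x \<delta>) G"
    and ae: "AE y in lborel. y \<in> ball x \<delta> \<longrightarrow>
      (\<exists>D. (G has_derivative D) (at y) \<and> b \<le> (\<Sum>e\<in>Basis. D e \<bullet> e))"
    and der: "(G has_derivative D0) (at x)"
  shows "b \<le> (\<Sum>e\<in>Basis. D0 e \<bullet> e)"
proof -
  interpret D0: bounded_linear D0 using der by (rule has_derivative_bounded_linear)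
  define G' where "G' y = G y - G x - D0 (y - x)" for y
  have D0': "(D0 has_derivative D0) (at y)" for y
    by (rule bounded_linear_imp_has_derivative) (rule D0.bounded_linear)
  have der': "(G' has_derivative (\<lambda>v. D v - D0 v)) (at y)" if "(G has_derivative D) (at y)" for y D
    unfolding G'_def D0.diff by (rule derivative_eq_intros that D0' refl)+ simp
  have "b - (\<Sum>e\<in>Basis. D0 e \<bullet> e) \<le> 0"
  proof (rule divergence_le_0[OF \<open>\<delta> > 0\<close>])
    have "(L + onorm D0)-lipschitz_on (ball x \<delta>) (\<lambda>y. (G y - D0 y) + (D0 x - G x))"
    proof -
      have "(onorm D0)-lipschitz_on (ball x \<delta>) D0"
        by (intro lipschitz_onI onorm_pos_le D0.bounded_linear)
          (metis D0.bounded_linear D0.diff dist_norm onorm)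
      from lipschitz_on_add[OF lipschitz_on_diff[OF lip this] lipschitz_on_constant]
      show ?thesis by simp
    qed
    then show "(L + onorm D0)-lipschitz_on (ball x \<delta>) G'"
      by (simp add: G'_def[abs_def] D0.diff algebra_simps)
    show "AE y in lborel. y \<in> ball x \<delta> \<longrightarrow> (\<exists>D. (G' has_derivative D) (at y) \<and>
        b - (\<Sum>e\<in>Basis. D0 e \<bullet> e) \<le> (\<Sum>e\<in>Basis. D e \<bullet> e))"
      using ae
    proof eventually_elim
      case (elim y)
      show ?case
      proof
        assume "y \<in> ball x \<delta>"
        then obtain D where "(G has_derivative D) (at y)" "b \<le> (\<Sum>e\<in>Basis. D e \<bullet> e)"
          using elim by blast
        then show "\<exists>D. (G' has_derivative D) (at y) \<and>
            b - (\<Sum>e\<in>Basis. D0 e \<bullet> e) \<le> (\<Sum>e\<in>Basis. D e \<bullet> e)"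
          by (intro exI[of _ "\<lambda>v. D v - D0 v"])
            (auto simp: inner_diff_left sum_subtractf intro: der')
      qed
    qed
    show "(G' has_derivative (\<lambda>v. 0)) (at x)" using der'[OF der] by simp
  qed (simp add: G'_def)
  then show ?thesis by simp
qed

section \<open>The non-singleton points\<close>

lemma nonsingleton_null:
  fixes \<Psi> :: "real^'n \<Rightarrow> (real^'n^'m) set"
  assumes "open \<Omega>" "semismooth_on F \<Omega> \<Psi>"
  shows "{x \<in> \<Omega>. \<exists>A\<in>cl_mf \<Psi> x. \<exists>B\<in>cl_mf \<Psi> x. A \<noteq> B} \<in> null_sets lborel"
proof -
  \<comment> \<open>The bound M confines the pair of matrices to a compact set, so N is a projection
    of a closed set along a compact factor and hence closed. This settles measurability.\<close>
  define N where "N u \<epsilon> M = {x. \<exists>p. p \<in> cball 0 M \<times> cball 0 M \<and>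
      (x, fst p) \<in> closure (gph \<Psi>) \<and> (x, snd p) \<in> closure (gph \<Psi>) \<and> \<epsilon> \<le> norm ((fst p - snd p) *v u)}"
    for u \<epsilon> M
  have closed_N: "closed (N u \<epsilon> M)" for u \<epsilon> M
  proof -
    have "closed {x. \<exists>p. p \<in> (cball 0 M \<times> cball 0 M) \<and> (p, x) \<in>
        {q. (snd q, fst (fst q)) \<in> closure (gph \<Psi>)} \<inter> {q. (snd q, snd (fst q)) \<in> closure (gph \<Psi>)}
         \<inter> {q. \<epsilon> \<le> norm ((fst (fst q) - snd (fst q)) *v u)}}"
    proof (intro closed_compact_projection compact_Times compact_cball closed_Int)
      have "closed ((\<lambda>q. (snd q, fst (fst q))) -` closure (gph \<Psi>))"
        "closed ((\<lambda>q. (snd q, snd (fst q))) -` closure (gph \<Psi>))"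
        by (intro closed_vimage closed_closure continuous_intros)+
      then show "closed {q. (snd q, fst (fst q)) \<in> closure (gph \<Psi>)}"
        "closed {q. (snd q, snd (fst q)) \<in> closure (gph \<Psi>)}"
        by (simp_all add: vimage_def)
      show "closed {q::((real^'n^'m) \<times> (real^'n^'m)) \<times> (real^'n). \<epsilon> \<le> norm ((fst (fst q) - snd (fst q)) *v u)}"
        unfolding matrix_vector_mult_def by (intro closed_Collect_le continuous_intros)
    qed
    then show ?thesis by (simp add: N_def)
  qed
  have "N u \<epsilon> M \<inter> \<Omega> \<in> null_sets lborel" if "\<epsilon> > 0" for u \<epsilon> M
  proof (rule null_sets_of_countable_on_lines[where e = u])
    show "N u \<epsilon> M \<inter> \<Omega> \<in> sets borel" using closed_N \<open>open \<Omega>\<close> by auto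
    fix y
    define T where "T = {t. y + t *\<^sub>R u \<in> \<Omega>}"
    define P where "P = {t. y + t *\<^sub>R u \<in> N u \<epsilon> M}"
    have "open T"
    proof -
      have "open ((\<lambda>t. y + t *\<^sub>R u) -` \<Omega>)"
        by (intro open_vimage \<open>open \<Omega>\<close> continuous_intros)
      then show ?thesis by (simp add: T_def vimage_def)
    qed
    moreover have "P sparse_in T"
      \<comment> \<open>Fix s and compare parameters t near s with the base point x0. Both matrices
        at x approximate the same increment F x - F x0, so their difference nearly annihilates x -
        x0, a nonzero multiple of u.\<close>
      unfolding sparse_in_open[OF \<open>open T\<close>]
    proof
      fix s assume "s \<in> T"
      define x0 where "x0 = y + s *\<^sub>R u"
      have "x0 \<in> \<Omega>" using \<open>s \<in> T\<close> by (simp add: T_def x0_def)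
      \<comment> \<open>With this constant the two errors together stay below
        \<open>2/3 * \<epsilon> * \<bar>t - s\<bar>\<close>, whatever the length of u.\<close>
      obtain d where d: "d > 0" "\<And>x A. x \<noteq> x0 \<Longrightarrow> dist x x0 < d \<Longrightarrow> A \<in> cl_mf \<Psi> x \<Longrightarrow>
          norm (F x - F x0 - A *v (x - x0)) \<le> (\<epsilon> / (3 * (norm u + 1))) * norm (x - x0)"
        using semismooth_on_eventually_cl_mf[OF assms \<open>x0 \<in> \<Omega>\<close>, of "\<epsilon> / (3 * (norm u + 1))"] \<open>\<epsilon> > 0\<close>
        unfolding eventually_at by (auto simp: add_nonneg_pos)
      have "t \<notin> P" if t: "t \<noteq> s" "\<bar>t - s\<bar> * norm u < d" for t
      proof
        assume "t \<in> P"
        define x where "x = y + t *\<^sub>R u"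
        obtain A B where AB: "A \<in> cl_mf \<Psi> x" "B \<in> cl_mf \<Psi> x" "\<epsilon> \<le> norm ((A - B) *v u)"
          using \<open>t \<in> P\<close> by (auto simp: P_def N_def cl_mf_def x_def)
        have diff: "x - x0 = (t - s) *\<^sub>R u" by (simp add: x_def x0_def algebra_simps)
        have "u \<noteq> 0" using AB(3) \<open>\<epsilon> > 0\<close> by auto
        then have "x \<noteq> x0" using diff t(1) by auto
        have "dist x x0 < d" using t(2) by (simp add: dist_norm diff)
        have "\<epsilon> * \<bar>t - s\<bar> \<le> norm ((A - B) *v (x - x0))"
          using AB(3) by (simp add: diff matrix_vector_mult_scaleR mult.commute[of \<epsilon>] mult_left_mono)
        also have "(A - B) *v (x - x0) = (F x - F x0 - B *v (x - x0)) - (F x - F x0 - A *v (x - x0))"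
          by (simp add: algebra_simps)
        also have "norm \<dots> \<le> (\<epsilon> / (3 * (norm u + 1))) * norm (x - x0) + (\<epsilon> / (3 * (norm u + 1))) * norm (x - x0)"
          using d(2)[OF \<open>x \<noteq> x0\<close> \<open>dist x x0 < d\<close> AB(1)] d(2)[OF \<open>x \<noteq> x0\<close> \<open>dist x x0 < d\<close> AB(2)]
          by (intro order_trans[OF norm_triangle_ineq4 add_mono])
        also have "\<dots> = \<epsilon> * \<bar>t - s\<bar> * (2 / 3 * (norm u / (norm u + 1)))"
          by (simp add: diff)
        also have "\<dots> < \<epsilon> * \<bar>t - s\<bar> * 1"
        proof (rule mult_strict_left_mono)
          have "norm u / (norm u + 1) \<le> 1" by (simp add: divide_simps add_nonneg_pos)
          then show "2 / 3 * (norm u / (norm u + 1)) < 1" by linarith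
        qed (use \<open>\<epsilon> > 0\<close> t(1) in auto)
        finally show False by simp
      qed
      moreover have "\<forall>\<^sub>F t in at s. \<bar>t - s\<bar> * norm u < d"
      proof -
        have "((\<lambda>t. \<bar>t - s\<bar> * norm u) \<longlongrightarrow> \<bar>s - s\<bar> * norm u) (at s)"
          by (intro tendsto_intros)
        then show ?thesis using \<open>d > 0\<close> by (auto dest!: order_tendstoD(2)[of _ _ _ d])
      qed
      ultimately have "\<forall>\<^sub>F t in at s. t \<notin> P"
        by (auto simp: eventually_at_filter elim: eventually_mono)
      then show "\<not> s islimpt P"
        by (simp add: islimpt_iff_eventually)
    qed
    ultimately have "countable (T \<inter> P)" by (rule sparse_imp_countable)
    then show "countable {t. y + t *\<^sub>R u \<in> N u \<epsilon> M \<inter> \<Omega>}"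
      by (rule countable_subset[rotated]) (auto simp: T_def P_def)
  qed
  then have "(\<Union>j. \<Union>k. \<Union>M. N (axis j 1) (1 / Suc k) (real M) \<inter> \<Omega>) \<in> null_sets lborel"
    by (intro null_sets_UN) auto
  \<comment> \<open>Distinct matrices differ in some column, by more than some 1 / (k + 1), and both
    are bounded by some natural number M. So countably many of the sets N suffice.\<close>
  moreover have "{x \<in> \<Omega>. \<exists>A\<in>cl_mf \<Psi> x. \<exists>B\<in>cl_mf \<Psi> x. A \<noteq> B}
      = (\<Union>j. \<Union>k. \<Union>M. N (axis j 1) (1 / Suc k) (real M) \<inter> \<Omega>)" (is "?L = ?R")
  proof (intro equalityI subsetI)
    fix x assume "x \<in> ?L"
    then obtain A B where x: "x \<in> \<Omega>" "A \<in> cl_mf \<Psi> x" "B \<in> cl_mf \<Psi> x" "A \<noteq> B" by blast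
    obtain j where "column j (A - B) \<noteq> 0"
      using \<open>A \<noteq> B\<close> by (auto simp: vec_eq_iff column_def)
    then have "0 < norm ((A - B) *v axis j 1)"
      by (simp add: matrix_vector_mult_basis)
    then obtain k where k: "1 / Suc k < norm ((A - B) *v axis j 1)"
      by (rule nat_approx_posE)
    obtain M where "max (norm A) (norm B) \<le> real M" using real_arch_simple by blast
    then have "x \<in> N (axis j 1) (1 / Suc k) (real M) \<inter> \<Omega>"
      using x k unfolding N_def by (intro IntI CollectI exI[of _ "(A, B)"]) (auto simp: cl_mf_def)
    then show "x \<in> ?R" by blast
  next
    fix x assume "x \<in> ?R"
    then obtain j k M where "x \<in> \<Omega>" "x \<in> N (axis j 1) (1 / Suc k) (real M)" by blast
    moreover from this obtain A B where "(x, A) \<in> closure (gph \<Psi>)" "(x, B) \<in> closure (gph \<Psi>)"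
      "1 / Suc k \<le> norm ((A - B) *v axis j 1)"
      by (auto simp: N_def)
    moreover from this have "A \<noteq> B" by auto
    ultimately show "x \<in> ?L" by (auto simp: cl_mf_def)
  qed
  ultimately show ?thesis by simp
qed

lemma is_singleton_cocl_iff: "is_singleton (cocl \<Psi> x) \<longleftrightarrow> is_singleton (cl_mf \<Psi> x)"
proof
  assume "is_singleton (cocl \<Psi> x)"
  then obtain A where A: "convex hull (cl_mf \<Psi> x) = {A}" by (auto simp: cocl_def is_singleton_def)
  then have "cl_mf \<Psi> x \<noteq> {}" by auto
  then have "cl_mf \<Psi> x = {A}" using A hull_subset[of "cl_mf \<Psi> x" convex] by auto
  then show "is_singleton (cl_mf \<Psi> x)" by simp
qed (auto simp: cocl_def is_singleton_def)

section \<open>The B-Jacobian\<close>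

lemma jacobian_eq_of_has_derivative:
  fixes F :: "real^'n \<Rightarrow> real^'m"
  assumes "(F has_derivative (\<lambda>v. A *v v)) (at x)"
  shows "jacobian F (at x) = A"
  unfolding jacobian_def frechet_derivative_at[OF assms, symmetric]
  by (rule matrix_of_matrix_vector_mul)

text \<open>Both sides are the trace of the product of \<open>transpose C\<close> and D. Thus a
  linear functional of the Jacobian of F becomes the divergence of a field on the domain
  space.\<close>

lemma inner_matrix_eq_divergence:
  fixes C D :: "real^'n^'m"
  shows "C \<bullet> D = (\<Sum>e\<in>Basis. (transpose C *v (D *v e)) \<bullet> e)"
proof -
  have "(transpose C *v w) \<bullet> axis j 1 = column j C \<bullet> w" for w j
    unfolding cart_eq_inner_axis[symmetric]
    by (simp add: matrix_vector_mult_def transpose_def column_def inner_vec_def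
        del: transpose_matrix_vector)
  then have "(\<Sum>e\<in>Basis. (transpose C *v (D *v e)) \<bullet> e) = (\<Sum>j\<in>UNIV. column j C \<bullet> column j D)"
    unfolding Basis_vec_def
    by (subst sum.UNION_disjoint)
      (auto simp: axis_eq_axis matrix_vector_mult_basis simp del: transpose_matrix_vector)
  also have "\<dots> = (\<Sum>j\<in>UNIV. \<Sum>i\<in>UNIV. C $ i $ j * D $ i $ j)"
    by (simp add: inner_vec_def column_def)
  also have "\<dots> = C \<bullet> D"
    by (subst sum.swap) (simp add: inner_vec_def)
  finally show ?thesis ..
qed

text \<open>The B-Jacobian admits every point of differentiability, including those in the
  exceptional null set. This lemma carries an almost everywhere lower bound over to all of them,
  through the divergence of the field \<open>?G\<close>.\<close>

lemma inner_jacobian_ge: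
  fixes F :: "real^'n \<Rightarrow> real^'m"
  assumes "\<delta> > 0" "L-lipschitz_on (ball x \<delta>) F"
    and "AE y in lborel. y \<in> ball x \<delta> \<longrightarrow> (\<exists>D. (F has_derivative (\<lambda>v. D *v v)) (at y) \<and> b \<le> C \<bullet> D)"
    and "(F has_derivative (\<lambda>v. D0 *v v)) (at x)"
  shows "b \<le> C \<bullet> D0"
  unfolding inner_matrix_eq_divergence
proof (rule divergence_ge[OF \<open>\<delta> > 0\<close>])
  let ?G = "\<lambda>y. transpose C *v F y"
  have lin: "bounded_linear (\<lambda>v. transpose C *v v)" by (rule matrix_vector_mul_bounded_linear)
  have "(onorm (\<lambda>v. transpose C *v v))-lipschitz_on (F ` ball x \<delta>) (\<lambda>v. transpose C *v v)"
    by (intro lipschitz_onI onorm_pos_le lin)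
      (metis lin matrix_vector_mult_diff_distrib dist_norm onorm)
  then show "(onorm (\<lambda>v. transpose C *v v) * L)-lipschitz_on (ball x \<delta>) ?G"
    using lipschitz_on_compose2[OF assms(2)] by blast
  have der: "(?G has_derivative (\<lambda>v. transpose C *v (D *v v))) (at y)"
    if "(F has_derivative (\<lambda>v. D *v v)) (at y)" for D y
    using bounded_linear.has_derivative[OF lin that] .
  show "(?G has_derivative (\<lambda>v. transpose C *v (D0 *v v))) (at x)"
    by (rule der) fact
  show "AE y in lborel. y \<in> ball x \<delta> \<longrightarrow>
    (\<exists>D. (?G has_derivative D) (at y) \<and> b \<le> (\<Sum>e\<in>Basis. D e \<bullet> e))"
    using assms(3) by eventually_elim (use der in \<open>auto simp: inner_matrix_eq_divergence\<close>)
qed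

lemma B_jacobian_subset_cocl:
  fixes \<Psi> :: "real^'n \<Rightarrow> (real^'n^'m) set"
  assumes "open \<Omega>" "semismooth_on F \<Omega> \<Psi>" "x \<in> \<Omega>"
  shows "B_jacobian F \<Omega> x \<subseteq> cocl \<Psi> x"
proof
  fix A assume "A \<in> B_jacobian F \<Omega> x"
  then obtain X where X: "\<And>k. X k \<in> diff_points F \<Omega>" "X \<longlonglongrightarrow> x" "(\<lambda>k. jacobian F (at (X k))) \<longlonglongrightarrow> A"
    unfolding B_jacobian_def by blast
  have lb: "locally_bounded_at \<Psi> x" using assms by (auto simp: semismooth_on_def semismooth_at_def)
  obtain r L where r: "r > 0" "ball x r \<subseteq> \<Omega>" "L-lipschitz_on (ball x r) F"
    using semismooth_on_lipschitz_near[OF assms] by metis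
  show "A \<in> cocl \<Psi> x"
  proof (rule ccontr)
    assume "A \<notin> cocl \<Psi> x"
    moreover have "closed (cocl \<Psi> x)"
      unfolding cocl_def by (intro compact_imp_closed compact_convex_hull compact_cl_mf lb)
    \<comment> \<open>The separation is strict on both sides: the gap above b gives an open
      half-space for upper semicontinuity, and the gap below b gives the final
      contradiction.\<close>
    ultimately obtain C b where C: "C \<bullet> A < b" "\<And>B. B \<in> cocl \<Psi> x \<Longrightarrow> b < C \<bullet> B"
      using separating_hyperplane_closed_point[of "cocl \<Psi> x" A] by (auto simp: cocl_def)
    obtain d where d: "d > 0" "\<And>y. y \<in> ball x d \<Longrightarrow> \<Psi> y \<subseteq> {B. b < C \<bullet> B}"
    proof (rule cl_mf_usc[OF lb])
      show "open {B. b < C \<bullet> B}" by (rule open_halfspace_gt)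
      show "cl_mf \<Psi> x \<subseteq> {B. b < C \<bullet> B}"
        using C(2) hull_subset[of "cl_mf \<Psi> x" convex] by (auto simp: cocl_def)
    qed blast
    define U where "U = ball x (min r d)"
    have U: "open U" "x \<in> U" "U \<subseteq> \<Omega>" using r d by (auto simp: U_def)
    have cl: "cl_mf \<Psi> y \<subseteq> {B. b \<le> C \<bullet> B}" if "y \<in> U" for y
    proof (rule cl_mf_subset[OF \<open>open U\<close> that])
      show "closed {B. b \<le> C \<bullet> B}" by (rule closed_halfspace_ge)
      show "\<Psi> z \<subseteq> {B. b \<le> C \<bullet> B}" if "z \<in> U" for z
        using d(2)[of z] that by (force simp: U_def)
    qed
    \<comment> \<open>Off the null set \<open>cl_mf \<Psi> y\<close> is a single matrix D, which is
      the derivative of F at y and lies in the closed half-space.\<close>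
    have "AE y in lborel. y \<notin> {x \<in> \<Omega>. \<exists>A\<in>cl_mf \<Psi> x. \<exists>B\<in>cl_mf \<Psi> x. A \<noteq> B}"
      by (rule AE_not_in) (rule nonsingleton_null[OF assms(1,2)])
    then have ae: "AE y in lborel. y \<in> U \<longrightarrow> (\<exists>D. (F has_derivative (\<lambda>v. D *v v)) (at y) \<and> b \<le> C \<bullet> D)"
    proof eventually_elim
      case (elim y)
      show ?case
      proof
        assume "y \<in> U"
        then have "y \<in> \<Omega>" using U by blast
        then have "\<Psi> y \<noteq> {}"
          using assms(2) interior_subset by (fastforce simp: semismooth_on_def semismooth_at_def mdom_def)
        then obtain D where "D \<in> cl_mf \<Psi> y" using subset_cl_mf by blast
        then have D: "cl_mf \<Psi> y = {D}" using elim \<open>y \<in> \<Omega>\<close> by blast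
        show "\<exists>D. (F has_derivative (\<lambda>v. D *v v)) (at y) \<and> b \<le> C \<bullet> D"
          using singleton_strictly_differentiable(2)[OF assms(1,2) \<open>y \<in> \<Omega>\<close> D] cl[OF \<open>y \<in> U\<close>] D by blast
      qed
    qed
    have ge: "b \<le> C \<bullet> jacobian F (at z)" if z: "z \<in> U" "z \<in> diff_points F \<Omega>" for z
    proof -
      obtain \<delta> where \<delta>: "\<delta> > 0" "ball z \<delta> \<subseteq> U" using U(1) z(1) openE by blast
      show ?thesis
      proof (rule inner_jacobian_ge[OF \<delta>(1)])
        show "L-lipschitz_on (ball z \<delta>) F"
          by (rule lipschitz_on_subset[OF r(3)]) (use \<delta>(2) in \<open>auto simp: U_def\<close>)
        show "AE y in lborel. y \<in> ball z \<delta> \<longrightarrow> (\<exists>D. (F has_derivative (\<lambda>v. D *v v)) (at y) \<and> b \<le> C \<bullet> D)"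
          using ae by eventually_elim (use \<delta>(2) in blast)
        show "(F has_derivative (\<lambda>v. jacobian F (at z) *v v)) (at z)"
          using z(2) by (simp add: diff_points_def jacobian_works[symmetric])
      qed
    qed
    have "\<forall>\<^sub>F k in sequentially. X k \<in> U" using X(2) U(1,2) by (rule topological_tendstoD)
    then have "\<forall>\<^sub>F k in sequentially. b \<le> C \<bullet> jacobian F (at (X k))"
      by (rule eventually_mono) (use ge X(1) in blast)
    then have "b \<le> C \<bullet> A"
      using tendsto_lowerbound[OF tendsto_inner[OF tendsto_const X(3)]] by simp
    then show False using C(1) by simp
  qed
qed

text \<open>Every neighbourhood of x has positive measure and so contains points where
  \<open>cl_mf \<Psi>\<close> is single-valued. The Jacobian there belongs to \<open>\<Psi>\<close>,
  so local boundedness and compactness provide a limit along points tending to x.\<close>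

lemma B_jacobian_nonempty:
  fixes \<Psi> :: "real^'n \<Rightarrow> (real^'n^'m) set"
  assumes "open \<Omega>" "semismooth_on F \<Omega> \<Psi>" "x \<in> \<Omega>"
  shows "B_jacobian F \<Omega> x \<noteq> {}"
proof -
  have "locally_bounded_at \<Psi> x" using assms by (auto simp: semismooth_on_def semismooth_at_def)
  then obtain r M where r: "r > 0" "M \<ge> 0"
    "\<And>y A. y \<in> ball x r \<Longrightarrow> A \<in> \<Psi> y \<Longrightarrow> norm A \<le> M"
    by (rule locally_bounded_at_norm) blast
  have "\<exists>y. y \<in> ball x (r / Suc k) \<and> y \<in> diff_points F \<Omega> \<and> jacobian F (at y) \<in> cball 0 M" for k
  proof -
    define V where "V = ball x (r / Suc k) \<inter> \<Omega>"
    let ?N = "{x \<in> \<Omega>. \<exists>A\<in>cl_mf \<Psi> x. \<exists>B\<in>cl_mf \<Psi> x. A \<noteq> B}"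
    have V: "open V" "x \<in> V" using assms r by (auto simp: V_def)
    have "\<not> V \<subseteq> ?N"
    proof
      assume "V \<subseteq> ?N"
      moreover have "negligible ?N"
        using nonsingleton_null[OF assms(1,2)] null_sets_completionI negligible_iff_null_sets by blast
      ultimately have "negligible V" by (rule negligible_subset[rotated])
      then show False using open_not_negligible[OF V(1)] V(2) by blast
    qed
    then obtain y where y: "y \<in> V" "y \<notin> ?N" by blast
    then have "y \<in> \<Omega>" by (simp add: V_def)
    then have "\<Psi> y \<noteq> {}"
      using assms(2) interior_subset by (fastforce simp: semismooth_on_def semismooth_at_def mdom_def)
    then obtain D where D: "D \<in> \<Psi> y" by blast
    then have "cl_mf \<Psi> y = {D}" using y(2) \<open>y \<in> \<Omega>\<close> subset_cl_mf[of \<Psi> y] by blast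
    from singleton_strictly_differentiable(2)[OF assms(1,2) \<open>y \<in> \<Omega>\<close> this]
    have der: "(F has_derivative (\<lambda>v. D *v v)) (at y)" .
    have "r / Suc k \<le> r" using r(1) by (simp add: divide_simps)
    then have "y \<in> ball x r" using y(1) by (auto simp: V_def)
    then have "norm D \<le> M" using r(3) D by blast
    then show ?thesis
      using y(1) \<open>y \<in> \<Omega>\<close> der jacobian_eq_of_has_derivative[OF der]
      by (intro exI[of _ y]) (auto simp: V_def diff_points_def differentiable_def)
  qed
  then obtain X where X: "\<And>k. X k \<in> ball x (r / Suc k)" "\<And>k. X k \<in> diff_points F \<Omega>"
    "\<And>k. jacobian F (at (X k)) \<in> cball 0 M" by metis
  have "X \<longlonglongrightarrow> x"
  proof (rule metric_tendsto_imp_tendsto)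
    show "(\<lambda>k. r / Suc k) \<longlonglongrightarrow> 0"
      using LIMSEQ_Suc[OF lim_const_over_n[of r]] by simp
    show "\<forall>\<^sub>F k in sequentially. dist (X k) x \<le> dist (r / Suc k) 0"
      using X(1) r(1) by (intro always_eventually) (auto simp: dist_commute less_imp_le)
  qed
  obtain A s where s: "strict_mono (s :: nat \<Rightarrow> nat)" "((\<lambda>k. jacobian F (at (X k))) \<circ> s) \<longlonglongrightarrow> A"
    using compact_cball[of 0 M] X(3) unfolding compact_def by metis
  have "A \<in> B_jacobian F \<Omega> x"
    unfolding B_jacobian_def
    using X(2) s(2) LIMSEQ_subseq_LIMSEQ[OF \<open>X \<longlonglongrightarrow> x\<close> s(1)]
    by (auto intro!: exI[of _ "X \<circ> s"] simp: o_def)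
  then show ?thesis by blast
qed

section \<open>Assembling the three statements\<close>

theorem theorem3p8:
  fixes F :: "real^'n \<Rightarrow> real^'m"
    and \<Omega> :: "(real^'n) set"
    and \<Psi> :: "real^'n \<Rightarrow> (real^'n^'m) set"
  assumes "open \<Omega>"
    and "semismooth_on F \<Omega> \<Psi>"
  shows "locally_lipschitz_on F \<Omega>
    \<and> (\<forall>x\<in>\<Omega>. convex hull (B_jacobian F \<Omega> x) \<noteq> {}
             \<and> convex hull (B_jacobian F \<Omega> x) \<subseteq> cocl \<Psi> x)
    \<and> \<Omega> - singleton_points \<Omega> \<Psi> \<in> null_sets lebesgue
    \<and> (\<forall>x\<in>singleton_points \<Omega> \<Psi>.
          strictly_differentiable_at F \<Omega> x
        \<and> F differentiable (at x)
        \<and> convex hull (B_jacobian F \<Omega> x) = {jacobian F (at x)}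
        \<and> {jacobian F (at x)} = cocl \<Psi> x
        \<and> cocl \<Psi> x = \<Psi> x)"
proof (intro conjI ballI)
  have \<Psi>_ne: "\<Psi> x \<noteq> {}" if "x \<in> \<Omega>" for x
    using assms(2) that interior_subset by (fastforce simp: semismooth_on_def semismooth_at_def mdom_def)
  show "locally_lipschitz_on F \<Omega>"
    unfolding locally_lipschitz_on_def
  proof
    fix x assume "x \<in> \<Omega>"
    then show "lipschitz_near F \<Omega> x"
      using semismooth_on_lipschitz_near[OF assms] unfolding lipschitz_near_def
      by (metis centre_in_ball inf.absorb1 open_ball)
  qed
  have sub: "convex hull (B_jacobian F \<Omega> x) \<subseteq> cocl \<Psi> x" if "x \<in> \<Omega>" for x
    by (rule hull_minimal[OF B_jacobian_subset_cocl[OF assms that]]) (simp add: cocl_def)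
  show "convex hull (B_jacobian F \<Omega> x) \<noteq> {}" "convex hull (B_jacobian F \<Omega> x) \<subseteq> cocl \<Psi> x"
    if "x \<in> \<Omega>" for x
    using B_jacobian_nonempty[OF assms that] sub[OF that] by simp_all
  have "\<Omega> - singleton_points \<Omega> \<Psi> \<subseteq> {x \<in> \<Omega>. \<exists>A\<in>cl_mf \<Psi> x. \<exists>B\<in>cl_mf \<Psi> x. A \<noteq> B}"
  proof
    fix x assume "x \<in> \<Omega> - singleton_points \<Omega> \<Psi>"
    then have "x \<in> \<Omega>" "\<not> is_singleton (cl_mf \<Psi> x)"
      by (auto simp: singleton_points_def is_singleton_cocl_iff)
    moreover from this obtain A where "A \<in> cl_mf \<Psi> x" using \<Psi>_ne subset_cl_mf by blast
    ultimately show "x \<in> {x \<in> \<Omega>. \<exists>A\<in>cl_mf \<Psi> x. \<exists>B\<in>cl_mf \<Psi> x. A \<noteq> B}"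
      unfolding is_singleton_def by blast
  qed
  then have "negligible (\<Omega> - singleton_points \<Omega> \<Psi>)"
    using nonsingleton_null[OF assms] null_sets_completionI negligible_iff_null_sets negligible_subset by blast
  then show "\<Omega> - singleton_points \<Omega> \<Psi> \<in> null_sets lebesgue"
    by (simp add: negligible_iff_null_sets)
  fix x assume "x \<in> singleton_points \<Omega> \<Psi>"
  then have "x \<in> \<Omega>" "is_singleton (cl_mf \<Psi> x)"
    by (auto simp: singleton_points_def is_singleton_cocl_iff)
  then obtain A where A: "cl_mf \<Psi> x = {A}" by (auto simp: is_singleton_def)
  note sd = singleton_strictly_differentiable[OF assms \<open>x \<in> \<Omega>\<close> A]
  show "strictly_differentiable_at F \<Omega> x" by (rule sd)
  show "F differentiable (at x)" using sd(2) by (rule differentiableI)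
  have cocl: "cocl \<Psi> x = {A}" by (simp add: cocl_def A)
  moreover have "jacobian F (at x) = A" by (rule jacobian_eq_of_has_derivative[OF sd(2)])
  \<comment> \<open>A nonempty subset of a singleton is the whole singleton; the same argument then
    identifies the hull of the B-Jacobian.\<close>
  moreover have "\<Psi> x = {A}" using \<Psi>_ne[OF \<open>x \<in> \<Omega>\<close>] subset_cl_mf[of \<Psi> x]
    unfolding A by (simp add: subset_singleton_iff)
  moreover have "convex hull (B_jacobian F \<Omega> x) = {A}"
    using B_jacobian_nonempty[OF assms \<open>x \<in> \<Omega>\<close>] sub[OF \<open>x \<in> \<Omega>\<close>] cocl
    by (metis convex_hull_eq_empty subset_singletonD)
  ultimately show "convex hull (B_jacobian F \<Omega> x) = {jacobian F (at x)}"
    "{jacobian F (at x)} = cocl \<Psi> x" "cocl \<Psi> x = \<Psi> x"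
    by auto
qed

end
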